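(* Let $m,n,r,s,\lambda$ be positive integers with $m>5$ and $n\ge 5m$. Any $r$-factorization of $\lambda K_m^5$ can be extended to a connected $s$-factorization of $\lambda K_n^5$ if and only if (i) $(m,r,\lambda)$ and $(n,s,\lambda)$ are $5$-admissible; (ii) $1<s/r\le\binom{n-1}{4}/\binom{m-1}{4}$.
   Context: $\lambda K_n^h$: $n$ vertices, every $h$-subset an edge of multiplicity $\lambda$; $\lambda K_m^h$ is its sub-hypergraph induced on a fixed set of $m$ vertices. An $r$-factor is a spanning sub-hypergraph in which every vertex has degree $r$; an $r$-factorization is a partition of the edges into $r$-factors. An $r$-factorization of $\lambda K_m^h$ extends to a connected $s$-factorization of $\lambda K_n^h$ if there is a partition of the edges of $\lambda K_n^h$ into connected $s$-factors such that each given $r$-factor is contained in one of them and distinct $r$-factors are contained in distinct $s$-factors. $(n,r,\lambda)$ is $h$-admissible if $h\mid rn$ and $r\mid\lambda\binom{n-1}{h-1}$. *)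

theory Defs
  imports Complex_Main "HOL-Library.Disjoint_Sets"
begin

text \<open>
  Parallel edges are distinguished by a label: an edge is a pair \<open>(A, i)\<close> of a vertex set
  and a copy index. An edge set is then an honest set, so a partition of the edges is
  \<^const>\<open>partition_on\<close>, and factors with the same underlying multiset of vertex sets
  but made of different copies count as distinct.
\<close>

type_synonym 'a hedge = "'a set \<times> nat"

definition complete_edges :: "nat \<Rightarrow> 'a set \<Rightarrow> nat \<Rightarrow> 'a hedge set" where
  "complete_edges l V h = {(A, i). A \<subseteq> V \<and> card A = h \<and> i < l}"

text \<open>The edges on \<open>M \<subseteq> V\<close> are those of the sub-hypergraph induced on \<open>M\<close>.\<close>

lemma complete_edges_induced:
  assumes "M \<subseteq> V"
  shows "complete_edges l M h = {e \<in> complete_edges l V h. fst e \<subseteq> M}"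
  using assms by (auto simp: complete_edges_def)

definition hdegree :: "'a hedge set \<Rightarrow> 'a \<Rightarrow> nat" where
  "hdegree F v = card {e \<in> F. v \<in> fst e}"

text \<open>A spanning sub-hypergraph of \<open>(V, E)\<close> is given by its edge set \<open>F\<close>.\<close>

definition is_factor :: "nat \<Rightarrow> 'a set \<Rightarrow> 'a hedge set \<Rightarrow> 'a hedge set \<Rightarrow> bool" where
  "is_factor r V E F \<longleftrightarrow> F \<subseteq> E \<and> (\<forall>v\<in>V. hdegree F v = r)"

definition is_factorization ::
    "nat \<Rightarrow> 'a set \<Rightarrow> 'a hedge set \<Rightarrow> 'a hedge set set \<Rightarrow> bool" where
  "is_factorization r V E P \<longleftrightarrow> partition_on E P \<and> (\<forall>F\<in>P. is_factor r V E F)"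

definition hadj :: "'a hedge set \<Rightarrow> ('a \<times> 'a) set" where
  "hadj F = {(u, v). \<exists>e\<in>F. u \<in> fst e \<and> v \<in> fst e}"

definition hconnected :: "'a set \<Rightarrow> 'a hedge set \<Rightarrow> bool" where
  "hconnected V F \<longleftrightarrow> (\<forall>u\<in>V. \<forall>v\<in>V. (u, v) \<in> (hadj F)\<^sup>*)"

definition is_connected_factorization ::
    "nat \<Rightarrow> 'a set \<Rightarrow> 'a hedge set \<Rightarrow> 'a hedge set set \<Rightarrow> bool" where
  "is_connected_factorization s V E Q \<longleftrightarrow>
     is_factorization s V E Q \<and> (\<forall>G\<in>Q. hconnected V G)"

definition extends_to_connected ::
    "'a hedge set set \<Rightarrow> nat \<Rightarrow> 'a set \<Rightarrow> 'a hedge set \<Rightarrow> bool" where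
  "extends_to_connected P s V E \<longleftrightarrow>
     (\<exists>Q. is_connected_factorization s V E Q
        \<and> (\<forall>F\<in>P. \<exists>G\<in>Q. F \<subseteq> G)
        \<and> (\<forall>F\<in>P. \<forall>F'\<in>P. \<forall>G\<in>Q. \<forall>G'\<in>Q.
              F \<noteq> F' \<longrightarrow> F \<subseteq> G \<longrightarrow> F' \<subseteq> G' \<longrightarrow> G \<noteq> G'))"

definition admissible :: "nat \<Rightarrow> nat \<Rightarrow> nat \<Rightarrow> nat \<Rightarrow> bool" where
  "admissible h n r l \<longleftrightarrow> h dvd r * n \<and> r dvd l * ((n - 1) choose (h - 1))"

end

theory Submission
  imports Defs
begin

text \<open>
  Sufficiency is proved by amalgamation and detachment. Let \<open>m = card M\<close> and
  \<open>N = n - m\<close>, so \<open>N \<ge> 4 * m\<close>. First amalgamate \<open>M\<close> to a single vertex and \<open>V - M\<close>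
  to another one: it then only has to be decided how many edges with \<open>t \<in> {1, 2, 3, 4}\<close> places
  in \<open>M\<close> each colour gets, with prescribed degree sum in \<open>M\<close>. This is a packing problem with so
  many items of size one that a greedy packing succeeds, and \<open>N \<ge> 4 * m\<close> ensures
  that the degree sum in \<open>V - M\<close> can be filled up with edges inside \<open>V - M\<close>. Then the
  vertices of \<open>M\<close>, and after them those of \<open>V - M\<close>, are split off one at a time. Each edge class
  and each colour gives the new vertex its proportional share, rounded to integers as in
  Baranyai's theorem.

  Connectedness is an additional rounding condition: deleting the amalgamated vertex splits a
  colour class into blocks, and the new vertex receives from every block its
  proportional share of edges as well. This preserves the inequality
  \<open>N + #blocks + #loops \<le> s * N + 1\<close>, which at \<open>N = 0\<close> leaves at most one block.
\<close>

section \<open>Integral rounding of flows\<close>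

text \<open>The numerical conditions have separate tasks. The upper bound on \<open>s / r\<close>
  says exactly that there are at least as many \<open>s\<close>-factors as given
  \<open>r\<close>-factors, so every given factor can have a colour of its own. The strict
  inequality \<open>r < s\<close> gives each vertex of \<open>M\<close>, in every colour, an edge
  that leaves \<open>M\<close>; so no block is isolated at the start. The condition
  \<open>5 dvd s * n\<close> makes the number of edges of one colour inside \<open>V - M\<close> an
  integer. The other balance conditions are Vandermonde identities. The factor 5 in
  \<open>n \<ge> 5 * m\<close> reflects the worst edges, those with one vertex in \<open>M\<close>
  and four places outside. All shares can be rounded simultaneously because the sums to be
  controlled form a tree for each colour (cells within groups within the colour) and a plain
  partition across colours. That is the shape of a flow network, whose incidence structure permits
  integral rounding.\<close>

lemma homogeneous_system_nontrivial:
  fixes a :: "'i \<Rightarrow> 'e \<Rightarrow> real"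
  assumes "finite I" "finite F" "card I < card F"
  shows "\<exists>z. (\<exists>e\<in>F. z e \<noteq> 0) \<and> (\<forall>i\<in>I. (\<Sum>e\<in>F. a i e * z e) = 0)"
  using assms
proof (induction I arbitrary: F a rule: finite_induct)
  case empty
  then have "F \<noteq> {}" by auto
  then show ?case by (intro exI[of _ "\<lambda>_. 1"]) auto
next
  case (insert i I)
  show ?case
  proof (cases "\<forall>e\<in>F. a i e = 0")
    case True
    have "card I < card F" using insert by simp
    from insert.IH[OF insert.prems(1) this, of a] True show ?thesis by auto
  next
    case False
    then obtain e0 where e0: "e0 \<in> F" "a i e0 \<noteq> 0" by auto
    define F' where "F' = F - {e0}"
    have F': "finite F'" "card I < card F'" "F = insert e0 F'" "e0 \<notin> F'"
      using insert e0 by (auto simp: F'_def)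
    \<comment> \<open>Gaussian elimination: equation \<open>i\<close> is solved for the coordinate
      \<open>e0\<close>, and the result is substituted into the other equations; \<open>z'\<close>
      restores that coordinate.\<close>
    from insert.IH[OF F'(1,2), of "\<lambda>k e. a k e - a k e0 * a i e / a i e0"]
    obtain z where z: "\<exists>e\<in>F'. z e \<noteq> 0"
      "\<And>k. k \<in> I \<Longrightarrow> (\<Sum>e\<in>F'. (a k e - a k e0 * a i e / a i e0) * z e) = 0" by blast
    define S where "S = (\<Sum>e\<in>F'. a i e * z e)"
    define z' where "z' = z(e0 := - S / a i e0)"
    have sum': "(\<Sum>e\<in>F. a k e * z' e) = a k e0 * (- S / a i e0) + (\<Sum>e\<in>F'. a k e * z e)" for k
    proof -
      have "(\<Sum>e\<in>F'. a k e * z' e) = (\<Sum>e\<in>F'. a k e * z e)"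
        using F'(4) by (intro sum.cong) (auto simp: z'_def)
      then show ?thesis using F' by (simp add: z'_def)
    qed
    have "(\<Sum>e\<in>F. a k e * z' e) = 0" if "k \<in> I" for k
    proof -
      have "(\<Sum>e\<in>F'. (a k e - a k e0 * a i e / a i e0) * z e)
          = (\<Sum>e\<in>F'. a k e * z e) - a k e0 / a i e0 * S"
        by (simp add: S_def left_diff_distrib sum_subtractf sum_distrib_left mult.assoc)
      with z(2)[OF that] show ?thesis unfolding sum' by simp
    qed
    moreover have "(\<Sum>e\<in>F. a i e * z' e) = 0"
      unfolding sum' using e0 by (simp add: S_def)
    moreover have "\<exists>e\<in>F. z' e \<noteq> 0"
      using z(1) F' by (auto simp: z'_def)
    ultimately show ?thesis by blast
  qed
qed

text \<open>The point travels along \<open>z\<close> until a coordinate first becomes an integer. Up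
  to that moment none has left the unit interval in which it started, so stopping at the least of
  the hitting times \<open>d e\<close> gives both claims.\<close>

lemma move_to_integer:
  fixes x z :: "'e \<Rightarrow> real"
  assumes "finite F" "\<exists>e\<in>F. z e \<noteq> 0" "\<And>e. e \<in> F \<Longrightarrow> x e \<notin> \<int>"
  shows "\<exists>t. (\<forall>e\<in>F. \<lfloor>x e\<rfloor> \<le> x e + t * z e \<and> x e + t * z e \<le> \<lceil>x e\<rceil>) \<and> (\<exists>e\<in>F. x e + t * z e \<in> \<int>)"
proof -
  define G where "G = {e\<in>F. z e \<noteq> 0}"
  define d where "d e = (if z e > 0 then (\<lceil>x e\<rceil> - x e) / z e else (x e - \<lfloor>x e\<rfloor>) / (- z e))" for e
  have G: "finite G" "G \<noteq> {}" using assms by (auto simp: G_def)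
  define t where "t = Min (d ` G)"
  have tle: "t \<le> d e" if "e \<in> G" for e using that G by (simp add: t_def)
  have dge: "d e \<ge> 0" for e
    unfolding d_def by (auto intro!: divide_nonneg_nonneg divide_nonneg_neg simp: divide_nonneg_nonpos)
  have t0: "t \<ge> 0" using G dge by (simp add: t_def)
  have tin: "t \<in> d ` G" unfolding t_def using G by (intro Min_in) auto
  then obtain e1 where e1: "e1 \<in> G" "t = d e1" by auto
  have hit: "x e1 + t * z e1 \<in> \<int>"
    using e1 by (auto simp: d_def G_def)
  have bounds: "\<lfloor>x e\<rfloor> \<le> x e + t * z e \<and> x e + t * z e \<le> \<lceil>x e\<rceil>" if e: "e \<in> F" for e
  proof (cases "z e" "0::real" rule: linorder_cases)
    case equal
    then show ?thesis by simp
  next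
    case greater
    then have "e \<in> G" using e by (simp add: G_def)
    from tle[OF this] greater have "t * z e \<le> \<lceil>x e\<rceil> - x e"
      by (simp add: d_def pos_le_divide_eq)
    moreover have "t * z e \<ge> 0" using t0 greater by simp
    moreover have "\<lfloor>x e\<rfloor> \<le> x e" by simp
    ultimately show ?thesis by linarith
  next
    case less
    then have "e \<in> G" using e by (simp add: G_def)
    from tle[OF this] less have "t \<le> (x e - \<lfloor>x e\<rfloor>) / (- z e)" by (simp only: d_def) simp
    then have "t * (- z e) \<le> x e - \<lfloor>x e\<rfloor>"
      by (subst (asm) pos_le_divide_eq) (use less in auto)
    moreover have "t * z e \<le> 0" using t0 less by (simp add: mult_nonneg_nonpos)
    moreover have "x e \<le> \<lceil>x e\<rceil>" by simp
    ultimately show ?thesis by linarith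
  qed
  show ?thesis using bounds hit e1 by (auto simp: G_def)
qed

definition netflow :: "('e \<Rightarrow> 'v) \<Rightarrow> ('e \<Rightarrow> 'v) \<Rightarrow> 'e set \<Rightarrow> ('e \<Rightarrow> real) \<Rightarrow> 'v \<Rightarrow> real" where
  "netflow src tgt E x v = (\<Sum>e\<in>E. (of_bool (src e = v) - of_bool (tgt e = v)) * x e)"

text \<open>A node that touches a fractional arc must touch two ends of such arcs, since a single
  one would make its net flow fractional. So there are at most as many nodes in \<open>U\<close> as
  arcs in \<open>F\<close>. The conservation equations add up to zero, hence the one at
  \<open>v0\<close> follows from the others; dropping it leaves fewer equations than unknowns. No
  cycle has to be traced.\<close>

lemma fractional_flow_direction:
  fixes x :: "'e \<Rightarrow> real"
  assumes E: "finite E" and int: "\<And>v. netflow src tgt E x v \<in> \<int>"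
    and F: "F = {e\<in>E. x e \<notin> \<int>}" "F \<noteq> {}"
  shows "\<exists>z. (\<exists>e\<in>F. z e \<noteq> 0) \<and> (\<forall>v. netflow src tgt F z v = 0)"
proof -
  define a where "a v e = (of_bool (src e = v) - of_bool (tgt e = v) :: real)" for v e
  have finF: "finite F" using E F by simp
  define U where "U = src ` F \<union> tgt ` F"
  have finU: "finite U" using finF by (simp add: U_def)
  have two: "2 \<le> card {e\<in>F. src e = v} + card {e\<in>F. tgt e = v}" if v: "v \<in> U" for v
  proof (rule ccontr)
    assume "\<not> ?thesis"
    then have le1: "card {e\<in>F. src e = v} + card {e\<in>F. tgt e = v} \<le> 1" by simp
    define K where "K = {e\<in>F. src e = v} \<union> {e\<in>F. tgt e = v}"
    have "card K \<le> 1" unfolding K_def using card_Un_le le1 by (rule le_trans)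
    moreover have "K \<noteq> {}" using v by (auto simp: K_def U_def)
    moreover have finK: "finite K" using finF by (simp add: K_def)
    ultimately have "card K = 1" by (meson card_0_eq le_antisym less_one not_less)
    then obtain e1 where e1: "K = {e1}" by (auto simp: card_1_singleton_iff)
    have e1F: "e1 \<in> F" using e1 unfolding K_def by auto
    \<comment> \<open>A loop at \<open>v\<close> counts at both ends and would already bring the
      total to 2. Excluding it makes the coefficient of \<open>x e1\<close> equal to 1 or -1, so
      that \<open>x e1\<close> is an integer.\<close>
    have notboth: "\<not> (src e1 = v \<and> tgt e1 = v)"
    proof
      assume "src e1 = v \<and> tgt e1 = v"
      then have "e1 \<in> {e\<in>F. src e = v}" "e1 \<in> {e\<in>F. tgt e = v}" using e1F by auto
      then have "card {e\<in>F. src e = v} > 0" "card {e\<in>F. tgt e = v} > 0"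
        using finF by (auto simp: card_gt_0_iff)
      then show False using le1 by simp
    qed
    have "src e1 = v \<or> tgt e1 = v" using e1 unfolding K_def by auto
    with notboth have a1: "a v e1 = 1 \<or> a v e1 = -1" by (auto simp: a_def)
    have "netflow src tgt E x v = a v e1 * x e1 + (\<Sum>e\<in>E-{e1}. a v e * x e)"
      unfolding netflow_def a_def using E e1F F by (subst sum.remove[of _ e1]) auto
    moreover have "(\<Sum>e\<in>E-{e1}. a v e * x e) \<in> \<int>"
    proof (rule Ints_sum)
      fix e assume e: "e \<in> E - {e1}"
      show "a v e * x e \<in> \<int>"
      proof (cases "e \<in> F")
        case True
        then have "e \<notin> K" using e e1 by auto
        then have "a v e = 0" using True by (auto simp: K_def a_def)
        then show ?thesis by simp
      next
        case False
        then have "x e \<in> \<int>" using e F by auto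
        moreover have "a v e \<in> \<int>" by (auto simp: a_def)
        ultimately show ?thesis by (rule Ints_mult[rotated])
      qed
    qed
    ultimately have "a v e1 * x e1 \<in> \<int>" using int[of v] by (metis Ints_diff add_diff_cancel_right')
    then have "x e1 \<in> \<int>" using a1 by auto
    then show False using e1F F by auto
  qed
  have "2 * card U \<le> (\<Sum>v\<in>U. card {e\<in>F. src e = v} + card {e\<in>F. tgt e = v})"
    using sum_mono[of U "\<lambda>_. 2", OF two] by (simp add: mult.commute)
  also have "\<dots> = 2 * card F"
  proof -
    have "(\<Sum>v\<in>U. card {e\<in>F. f e = v}) = card F" if "f ` F \<subseteq> U" for f
    proof -
      have "(\<Sum>v\<in>U. card {e\<in>F. f e = v}) = (\<Sum>v\<in>U. \<Sum>e | e \<in> F \<and> f e = v. 1)" by simp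
      also have "\<dots> = (\<Sum>e\<in>F. 1)" by (rule sum.group[OF finF finU that])
      finally show ?thesis by simp
    qed
    from this[of src] this[of tgt] show ?thesis by (simp add: sum.distrib U_def)
  qed
  finally have cUF: "card U \<le> card F" by simp
  obtain v0 where v0: "v0 \<in> U" using F(2) by (auto simp: U_def)
  have "card (U - {v0}) < card F" using cUF v0 finU by (metis card_Diff1_less order_less_le_trans)
  from homogeneous_system_nontrivial[OF _ finF this, of a] finU
  obtain z where z: "\<exists>e\<in>F. z e \<noteq> 0" "\<And>v. v \<in> U - {v0} \<Longrightarrow> (\<Sum>e\<in>F. a v e * z e) = 0" by blast
  have out: "(\<Sum>e\<in>F. a v e * z e) = 0" if "v \<notin> U" for v
    using that by (intro sum.neutral) (auto simp: a_def U_def)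
  have "(\<Sum>v\<in>U. \<Sum>e\<in>F. a v e * z e) = (\<Sum>e\<in>F. \<Sum>v\<in>U. a v e * z e)" by (rule sum.swap)
  also have "\<dots> = 0"
  proof (rule sum.neutral, rule ballI)
    fix e assume e: "e \<in> F"
    have "(\<Sum>v\<in>U. a v e) = 0"
      using e finU by (auto simp: a_def U_def sum_subtractf of_bool_def sum.delta')
    then show "(\<Sum>v\<in>U. a v e * z e) = 0" by (simp flip: sum_distrib_right)
  qed
  also have "(\<Sum>v\<in>U. \<Sum>e\<in>F. a v e * z e) = (\<Sum>e\<in>F. a v0 e * z e)"
    using v0 finU z(2) by (subst sum.remove[of _ v0]) auto
  finally have "(\<Sum>e\<in>F. a v e * z e) = 0" for v using z(2) out by (cases "v = v0"; cases "v \<in> U") auto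
  then show ?thesis using z(1) by (auto simp: netflow_def a_def)
qed

text \<open>Each move along a conserving direction supported on the fractional arcs makes one more
  arc integral and leaves the integral ones alone. The bounds are inherited because a value never
  leaves the interval from its floor to its ceiling, so that later floors and ceilings are only
  tighter.\<close>

theorem integral_flow_rounding:
  fixes x :: "'e \<Rightarrow> real"
  assumes E: "finite E" and int: "\<And>v. netflow src tgt E x v \<in> \<int>"
  shows "\<exists>y::'e \<Rightarrow> int. (\<forall>v. netflow src tgt E (\<lambda>e. of_int (y e)) v = netflow src tgt E x v)
    \<and> (\<forall>e\<in>E. \<lfloor>x e\<rfloor> \<le> y e \<and> y e \<le> \<lceil>x e\<rceil>)"
  using int
proof (induction "card {e\<in>E. x e \<notin> \<int>}" arbitrary: x rule: less_induct)
  case (less x)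
  define F where "F = {e\<in>E. x e \<notin> \<int>}"
  have finF: "finite F" using E by (simp add: F_def)
  show ?case
  proof (cases "F = {}")
    case True
    then have "real_of_int \<lfloor>x e\<rfloor> = x e" if "e \<in> E" for e
      using that by (auto simp: F_def of_int_floor)
    then show ?thesis
      by (intro exI[of _ "\<lambda>e. \<lfloor>x e\<rfloor>"])
        (auto simp: netflow_def floor_le_ceiling intro!: sum.cong)
  next
    case False
    from fractional_flow_direction[OF E less.prems F_def False]
    obtain z where z: "\<exists>e\<in>F. z e \<noteq> 0" "\<And>v. netflow src tgt F z v = 0" by blast
    have "x e \<notin> \<int>" if "e \<in> F" for e using that by (simp add: F_def)
    with move_to_integer[OF finF z(1), of x]
    obtain t where t: "\<And>e. e \<in> F \<Longrightarrow> \<lfloor>x e\<rfloor> \<le> x e + t * z e \<and> x e + t * z e \<le> \<lceil>x e\<rceil>"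
      and hit: "\<exists>e\<in>F. x e + t * z e \<in> \<int>" by blast
    define x' where "x' e = x e + t * (if e \<in> F then z e else 0)" for e
    have net: "netflow src tgt E x' v = netflow src tgt E x v" for v
    proof -
      have "netflow src tgt E x' v = netflow src tgt E x v
          + t * (\<Sum>e\<in>E. (of_bool (src e = v) - of_bool (tgt e = v)) * (if e \<in> F then z e else 0))"
        by (simp add: netflow_def x'_def distrib_left sum.distrib sum_distrib_left mult_ac)
      also have "(\<Sum>e\<in>E. (of_bool (src e = v) - of_bool (tgt e = v)) * (if e \<in> F then z e else 0))
          = netflow src tgt F z v"
        unfolding netflow_def using E by (intro sum.mono_neutral_cong_right) (auto simp: F_def)
      finally show ?thesis using z(2) by simp
    qed
    have "{e\<in>E. x' e \<notin> \<int>} \<subset> F" using hit by (auto simp: x'_def F_def)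
    then have "card {e\<in>E. x' e \<notin> \<int>} < card {e\<in>E. x e \<notin> \<int>}"
      unfolding F_def[symmetric] using finF by (rule psubset_card_mono[rotated])
    from less.hyps[OF this] less.prems net obtain y :: "'e \<Rightarrow> int" where
      y: "\<And>v. netflow src tgt E (\<lambda>e. of_int (y e)) v = netflow src tgt E x' v"
         "\<And>e. e \<in> E \<Longrightarrow> \<lfloor>x' e\<rfloor> \<le> y e \<and> y e \<le> \<lceil>x' e\<rceil>" by metis
    have "\<lfloor>x e\<rfloor> \<le> y e \<and> y e \<le> \<lceil>x e\<rceil>" if "e \<in> E" for e
    proof (cases "e \<in> F")
      case True
      then have "\<lfloor>x e\<rfloor> \<le> \<lfloor>x' e\<rfloor>" "\<lceil>x' e\<rceil> \<le> \<lceil>x e\<rceil>"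
        using t[OF True] by (auto simp: x'_def le_floor_iff ceiling_le_iff)
      then show ?thesis using y(2)[OF that] by linarith
    next
      case False
      then show ?thesis using y(2)[OF that] by (simp add: x'_def)
    qed
    then show ?thesis using y(1) net by metis
  qed
qed

text \<open>Each colour \<open>j\<close> is a node with one arc to each of its groups, which has one arc to each of
  its cells' columns; the fractional flow sends \<open>w z * c j z / N\<close> through the cell \<open>(j, z)\<close>.\<close>
lemma fair_share:
  fixes c :: "'j \<Rightarrow> 'z \<Rightarrow> nat" and w :: "'z \<Rightarrow> nat" and g :: "'j \<Rightarrow> 'z \<Rightarrow> 'y"
  assumes fin: "finite J" "finite Z" and N: "N > 0"
    and row: "\<And>j. j \<in> J \<Longrightarrow> (\<Sum>z\<in>Z. w z * c j z) = \<sigma> j * N"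
    and col: "\<And>z. z \<in> Z \<Longrightarrow> (\<Sum>j\<in>J. w z * c j z) = \<kappa> z * N"
  shows "\<exists>b :: 'j \<Rightarrow> 'z \<Rightarrow> nat.
      (\<forall>j\<in>J. (\<Sum>z\<in>Z. b j z) = \<sigma> j) \<and> (\<forall>z\<in>Z. (\<Sum>j\<in>J. b j z) = \<kappa> z)
    \<and> (\<forall>j\<in>J. \<forall>z\<in>Z. b j z * N < w z * c j z + N)
    \<and> (\<forall>j\<in>J. \<forall>y. (\<Sum>z | z \<in> Z \<and> g j z = y. b j z) * N < (\<Sum>z | z \<in> Z \<and> g j z = y. w z * c j z) + N)"
proof -
  define D where "D = (\<lambda>(j, y). \<Sum>z | z \<in> Z \<and> g j z = y. w z * c j z)"
  \<comment> \<open>Only labels that occur become nodes, which keeps the network finite; for any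
    other label the two sums in the last claim are empty.\<close>
  define Gr where "Gr = (SIGMA j:J. g j ` Z)"
  define E where "E = (J \<times> Z) <+> Gr"
  define src where "src = case_sum (\<lambda>(j, z). Inr (Inl (j, g j z))) (\<lambda>(j::'j, y::'y). Inl j :: 'j + ('j \<times> 'y) + 'z)"
  define tgt where "tgt = case_sum (\<lambda>(j::'j, z). Inr (Inr z)) (\<lambda>(j, y). Inr (Inl (j, y)) :: 'j + ('j \<times> 'y) + 'z)"
  define x where "x = case_sum (\<lambda>(j, z). real (w z * c j z) / N) (\<lambda>p. real (D p) / N)"
  have finGr: "finite Gr" using fin by (simp add: Gr_def)
  have finE: "finite E" using fin finGr by (simp add: E_def)
  have net: "netflow src tgt E f v = (case v of
      Inl j \<Rightarrow> if j \<in> J then (\<Sum>y\<in>g j ` Z. f (Inr (j, y))) else 0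
    | Inr (Inl (j, y)) \<Rightarrow> if (j, y) \<in> Gr then (\<Sum>z | z \<in> Z \<and> g j z = y. f (Inl (j, z))) - f (Inr (j, y)) else 0
    | Inr (Inr z) \<Rightarrow> if z \<in> Z then - (\<Sum>j\<in>J. f (Inl (j, z))) else 0)" for f :: "_ \<Rightarrow> real" and v
  proof -
    have split: "netflow src tgt E f v =
        (\<Sum>j\<in>J. \<Sum>z\<in>Z. (of_bool (Inr (Inl (j, g j z)) = v) - of_bool (Inr (Inr z) = v)) * f (Inl (j, z)))
      + (\<Sum>j\<in>J. \<Sum>y\<in>g j ` Z. (of_bool (Inl j = v) - of_bool (Inr (Inl (j, y)) = v)) * f (Inr (j, y)))"
      unfolding netflow_def E_def using fin finGr
      by (simp add: sum.Plus src_def tgt_def sum.cartesian_product sum.Sigma Gr_def case_prod_unfold)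
    show ?thesis
    proof (cases v)
      case (Inl j)
      have "(\<Sum>i\<in>J. \<Sum>y\<in>g i ` Z. (of_bool (Inl i = v) - of_bool (Inr (Inl (i, y)) = v)) * f (Inr (i, y)))
         = (\<Sum>i\<in>J. if i = j then \<Sum>y\<in>g j ` Z. f (Inr (j, y)) else 0)"
        using Inl by (intro sum.cong) auto
      then show ?thesis unfolding split using fin Inl by (simp add: sum.delta')
    next
      case (Inr u)
      show ?thesis
      proof (cases u)
        case [simp]: (Inr z)
        show ?thesis unfolding split using fin \<open>v = Inr u\<close>
          by (simp add: of_bool_def if_distrib[of "\<lambda>t. t * _"] sum.delta' sum_negf cong: if_cong)
      next
        case [simp]: (Inl p)
        obtain j y where [simp]: "p = (j, y)" by (cases p)
        have 1: "(\<Sum>i\<in>J. \<Sum>z\<in>Z. (of_bool (Inr (Inl (i, g i z)) = v) - of_bool (Inr (Inr z) = v)) * f (Inl (i, z)))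
           = (\<Sum>i\<in>J. if i = j then (\<Sum>z\<in>Z. of_bool (g j z = y) * f (Inl (j, z))) else 0)"
          using \<open>v = Inr u\<close> by (intro sum.cong) auto
        have 2: "(\<Sum>i\<in>J. \<Sum>y'\<in>g i ` Z. (of_bool (Inl i = v) - of_bool (Inr (Inl (i, y')) = v)) * f (Inr (i, y')))
           = (\<Sum>i\<in>J. if i = j then (\<Sum>y'\<in>g j ` Z. if y' = y then - f (Inr (j, y)) else 0) else 0)"
          using \<open>v = Inr u\<close> by (intro sum.cong) (auto intro!: sum.cong)
        have 3: "(\<Sum>z\<in>Z. of_bool (g j z = y) * f (Inl (j, z))) = (\<Sum>z | z \<in> Z \<and> g j z = y. f (Inl (j, z)))"
          using fin by (intro sum.mono_neutral_cong_right) auto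
        have 4: "(\<Sum>z | z \<in> Z \<and> g j z = y. f (Inl (j, z))) = 0" if "y \<notin> g j ` Z"
          using that by (intro sum.neutral) auto
        show ?thesis unfolding split 1 2 3 using fin 4 \<open>v = Inr u\<close> by (auto simp: sum.delta' Gr_def)
      qed
    qed
  qed
  have N': "real N > 0" using N by simp
  have group_flow: "(\<Sum>z | z \<in> Z \<and> g j z = y. x (Inl (j, z))) = x (Inr (j, y))" for j y
    by (simp add: x_def D_def sum_divide_distrib)
  \<comment> \<open>Group nodes conserve the fractional flow, and the row and column hypotheses make
    it integral at the remaining nodes. This is what rounding needs.\<close>
  have netx: "netflow src tgt E x v = (case v of
      Inl j \<Rightarrow> if j \<in> J then of_nat (\<sigma> j) else 0
    | Inr (Inl (j, y)) \<Rightarrow> 0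
    | Inr (Inr z) \<Rightarrow> if z \<in> Z then - of_nat (\<kappa> z) else 0)" for v
  proof -
    have "(\<Sum>y\<in>g j ` Z. x (Inr (j, y))) = \<sigma> j" if "j \<in> J" for j
    proof -
      have "(\<Sum>y\<in>g j ` Z. x (Inr (j, y))) = real (\<Sum>y\<in>g j ` Z. D (j, y)) / N"
        by (simp add: x_def sum_divide_distrib)
      also have "(\<Sum>y\<in>g j ` Z. D (j, y)) = (\<Sum>z\<in>Z. w z * c j z)"
        unfolding D_def prod.case by (rule sum.group) (use fin in auto)
      finally show ?thesis using row[OF that] N by simp
    qed
    moreover have "(\<Sum>j\<in>J. x (Inl (j, z))) = \<kappa> z" if "z \<in> Z" for z
    proof -
      have "(\<Sum>j\<in>J. x (Inl (j, z))) = real (\<Sum>j\<in>J. w z * c j z) / N"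
        by (simp add: x_def sum_divide_distrib)
      then show ?thesis using col[OF that] N by simp
    qed
    ultimately show ?thesis unfolding net by (auto simp: group_flow split: sum.split)
  qed
  have "netflow src tgt E x v \<in> \<int>" for v
    unfolding netx by (auto split: sum.split)
  from integral_flow_rounding[OF finE this] obtain y :: "_ \<Rightarrow> int" where
    y: "\<And>v. netflow src tgt E (\<lambda>e. of_int (y e)) v = netflow src tgt E x v"
    and yr: "\<And>e. e \<in> E \<Longrightarrow> \<lfloor>x e\<rfloor> \<le> y e \<and> y e \<le> \<lceil>x e\<rceil>" by blast
  have x0: "x e \<ge> 0" for e by (auto simp: x_def split: sum.split)
  have y0: "y e \<ge> 0" if "e \<in> E" for e
  proof -
    have "\<lfloor>x e\<rfloor> \<ge> 0" using x0 by simp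
    then show ?thesis using yr[OF that] by linarith
  qed
  \<comment> \<open>A rounded value is less than its real value plus one; clearing the denominator
    \<open>N\<close> yields the strict bounds with the summand \<open>N\<close>.\<close>
  have up: "real_of_int (y e) * N < x e * N + N" if "e \<in> E" for e
  proof -
    have "y e < x e + 1" using yr[OF that] by linarith
    then have "real_of_int (y e) * N < (x e + 1) * N" using N' by (rule mult_strict_right_mono)
    then show ?thesis by (simp add: algebra_simps)
  qed
  define b where "b j z = nat (y (Inl (j, z)))" for j z
  have cellE: "Inl (j, z) \<in> E" if "j \<in> J" "z \<in> Z" for j z using that by (auto simp: E_def)
  have grE: "Inr (j, u) \<in> E" if "(j, u) \<in> Gr" for j u using that by (auto simp: E_def)
  have b: "real (b j z) = y (Inl (j, z))" if "j \<in> J" "z \<in> Z" for j z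
    using y0[OF cellE[OF that]] by (simp add: b_def)
  have grp: "real (\<Sum>z | z \<in> Z \<and> g j z = u. b j z) = y (Inr (j, u))" if "(j, u) \<in> Gr" for j u
  proof -
    have "j \<in> J" using that by (auto simp: Gr_def)
    then have "real (\<Sum>z | z \<in> Z \<and> g j z = u. b j z) = (\<Sum>z | z \<in> Z \<and> g j z = u. of_int (y (Inl (j, z))))"
      by (simp add: b)
    then show ?thesis using y[of "Inr (Inl (j, u))"] that unfolding net by (simp add: group_flow)
  qed
  have "(\<Sum>z\<in>Z. b j z) = \<sigma> j" if j: "j \<in> J" for j
  proof -
    have "(\<Sum>z\<in>Z. b j z) = (\<Sum>u\<in>g j ` Z. \<Sum>z | z \<in> Z \<and> g j z = u. b j z)"
      by (rule sum.group[symmetric]) (use fin in auto)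
    also have "real \<dots> = (\<Sum>u\<in>g j ` Z. real (\<Sum>z | z \<in> Z \<and> g j z = u. b j z))" by (rule of_nat_sum)
    also have "\<dots> = (\<Sum>u\<in>g j ` Z. of_int (y (Inr (j, u))))"
      using j by (intro sum.cong grp) (auto simp: Gr_def)
    also have "\<dots> = \<sigma> j" using y[of "Inl j", unfolded netx] j by (simp add: net)
    finally show ?thesis by (simp only: of_nat_eq_iff)
  qed
  moreover have "(\<Sum>j\<in>J. b j z) = \<kappa> z" if z: "z \<in> Z" for z
  proof -
    have "real (\<Sum>j\<in>J. b j z) = (\<Sum>j\<in>J. of_int (y (Inl (j, z))))" using z by (simp add: b)
    also have "\<dots> = \<kappa> z" using y[of "Inr (Inr z)", unfolded netx] z by (simp add: net)
    finally show ?thesis by (simp only: of_nat_eq_iff)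
  qed
  moreover have "b j z * N < w z * c j z + N" if "j \<in> J" "z \<in> Z" for j z
  proof -
    have "real (b j z * N) < real (w z * c j z + N)"
      using up[OF cellE[OF that]] b[OF that] N by (simp add: x_def)
    then show ?thesis by (simp only: of_nat_less_iff)
  qed
  moreover have "(\<Sum>z | z \<in> Z \<and> g j z = u. b j z) * N < (\<Sum>z | z \<in> Z \<and> g j z = u. w z * c j z) + N"
    if j: "j \<in> J" for j u
  proof (cases "u \<in> g j ` Z")
    case True
    then have Gr: "(j, u) \<in> Gr" using j by (simp add: Gr_def)
    have "real ((\<Sum>z | z \<in> Z \<and> g j z = u. b j z) * N) < real (D (j, u) + N)"
      using up[OF grE[OF Gr]] grp[OF Gr] N by (simp add: x_def)
    then show ?thesis unfolding D_def by (simp only: of_nat_less_iff prod.case)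
  next
    case False
    then have none: "{z. z \<in> Z \<and> g j z = u} = {}" by auto
    show ?thesis unfolding none using N by simp
  qed
  ultimately show ?thesis by (intro exI[of _ b]) blast
qed

section \<open>Splitting a vertex off an amalgamated hypergraph\<close>

lemma sum_Pow_insert:
  assumes "finite W" "x \<notin> W"
  shows "(\<Sum>A\<in>Pow (insert x W). f A) = (\<Sum>A\<in>Pow W. f A + f (insert x A))"
proof -
  have "inj_on (insert x) (Pow W)" using assms by (auto simp: inj_on_def)
  then have "(\<Sum>A\<in>insert x ` Pow W. f A) = (\<Sum>A\<in>Pow W. f (insert x A))"
    by (simp add: sum.reindex)
  moreover have "Pow W \<inter> insert x ` Pow W = {}" using assms by auto
  ultimately show ?thesis using assms
    by (simp add: Pow_insert sum.union_disjoint sum.distrib)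
qed

text \<open>An edge of type \<open>t\<close> has \<open>t\<close> places, filled by vertices of \<open>W\<close> and by copies of one further
  vertex, which stands for \<open>N\<close> vertices not yet separated; \<open>c j t A\<close> counts the edges of colour
  \<open>j\<close> and type \<open>t\<close> that meet \<open>W\<close> exactly in \<open>A\<close>.\<close>
definition amalgam :: "nat set \<Rightarrow> (nat \<Rightarrow> nat) \<Rightarrow> 'j set \<Rightarrow> ('j \<Rightarrow> nat) \<Rightarrow> nat \<Rightarrow> 'a set
    \<Rightarrow> ('j \<Rightarrow> nat \<Rightarrow> 'a set \<Rightarrow> nat) \<Rightarrow> bool" where
  "amalgam T \<Lambda> J \<sigma> N W c \<longleftrightarrow>
     (\<forall>j\<in>J. \<forall>t\<in>T. \<forall>A. c j t A > 0 \<longrightarrow> A \<subseteq> W \<and> card A \<le> t) \<and>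
     (\<forall>t\<in>T. \<forall>A. A \<subseteq> W \<longrightarrow> card A \<le> t \<longrightarrow> (\<Sum>j\<in>J. c j t A) = \<Lambda> t * (N choose (t - card A))) \<and>
     (\<forall>j\<in>J. \<forall>v\<in>W. (\<Sum>t\<in>T. \<Sum>A\<in>Pow W. of_bool (v \<in> A) * c j t A) = \<sigma> j) \<and>
     (\<forall>j\<in>J. (\<Sum>t\<in>T. \<Sum>A\<in>Pow W. (t - card A) * c j t A) = \<sigma> j * N)"

text \<open>Here \<open>b A\<close> is the number of edges with trace \<open>A\<close> that hand one
  of their free places to the new vertex \<open>x\<close> and from then on have trace
  \<open>insert x A\<close>.\<close>

definition split_off :: "'a \<Rightarrow> ('a set \<Rightarrow> nat) \<Rightarrow> ('a set \<Rightarrow> nat) \<Rightarrow> 'a set \<Rightarrow> nat" where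
  "split_off x c b A = (if x \<in> A then b (A - {x}) else c A - b A)"

text \<open>The fair share of the new vertex is a fraction \<open>1 / Suc N\<close> of all free
  places. It is integral for a colour because the free places number
  \<open>\<sigma> j * Suc N\<close>, and for a class of edges by the absorption identity of binomial
  coefficients; in between it is rounded. The labelling \<open>g\<close> is arbitrary so that
  connectedness can impose its own groups.\<close>

lemma amalgam_step:
  fixes g :: "'j \<Rightarrow> nat \<times> 'a set \<Rightarrow> 'y"
  assumes am: "amalgam T \<Lambda> J \<sigma> (Suc N) W c"
    and fin: "finite T" "finite J" "finite W" and x: "x \<notin> W"
  shows "\<exists>b. amalgam T \<Lambda> J \<sigma> N (insert x W) (\<lambda>j t. split_off x (c j t) (b j t)) \<and>
    (\<forall>j\<in>J. \<forall>t\<in>T. \<forall>A. b j t A \<le> c j t A \<and> b j t A \<le> (t - card A) * c j t A) \<and>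
    (\<forall>j\<in>J. (\<Sum>t\<in>T. \<Sum>A\<in>Pow W. b j t A) = \<sigma> j) \<and>
    (\<forall>j\<in>J. \<forall>y. (\<Sum>(t, A) | (t, A) \<in> T \<times> Pow W \<and> g j (t, A) = y. b j t A) * Suc N
       < (\<Sum>(t, A) | (t, A) \<in> T \<times> Pow W \<and> g j (t, A) = y. (t - card A) * c j t A) + Suc N)"
proof -
  have supp: "A \<subseteq> W" "card A \<le> t" if "c j t A > 0" "j \<in> J" "t \<in> T" for j t A
    using am that unfolding amalgam_def by blast+
  have col: "(\<Sum>j\<in>J. c j t A) = \<Lambda> t * (Suc N choose (t - card A))"
    if "t \<in> T" "A \<subseteq> W" "card A \<le> t" for t A
    using am that unfolding amalgam_def by blast
  have deg: "(\<Sum>t\<in>T. \<Sum>A\<in>Pow W. of_bool (v \<in> A) * c j t A) = \<sigma> j" if "j \<in> J" "v \<in> W" for j v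
    using am that unfolding amalgam_def by blast
  have tot: "(\<Sum>t\<in>T. \<Sum>A\<in>Pow W. (t - card A) * c j t A) = \<sigma> j * Suc N" if "j \<in> J" for j
    using am that unfolding amalgam_def by blast
  define Z where "Z = T \<times> Pow W"
  define w where "w = (\<lambda>(t, A::'a set). t - card A)"
  define c' where "c' j = (\<lambda>(t, A). c j t A)" for j
  \<comment> \<open>The number of edges of this class that must contain \<open>x\<close> in the
    complete hypergraph: one place goes to \<open>x\<close>, the others to the \<open>N\<close>
    remaining vertices. The case distinction guards the truncated subtraction.\<close>
  define \<kappa> where "\<kappa> = (\<lambda>(t, A::'a set). if card A < t then \<Lambda> t * (N choose (t - card A - 1)) else 0)"
  have finZ: "finite Z" using fin by (simp add: Z_def)
  have row': "(\<Sum>z\<in>Z. w z * c' j z) = \<sigma> j * Suc N" if "j \<in> J" for j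
    using tot[OF that] by (simp add: Z_def w_def c'_def sum.cartesian_product case_prod_unfold)
  have col': "(\<Sum>j\<in>J. w z * c' j z) = \<kappa> z * Suc N" if zZ: "z \<in> Z" for z
  proof -
    obtain t A where z: "z = (t, A)" "t \<in> T" "A \<subseteq> W" using zZ by (auto simp: Z_def)
    show ?thesis
    proof (cases "card A < t")
      case False
      then show ?thesis by (simp add: z w_def \<kappa>_def)
    next
      case True
      have "(\<Sum>j\<in>J. w z * c' j z) = (t - card A) * (\<Sum>j\<in>J. c j t A)"
        by (simp add: z w_def c'_def sum_distrib_left)
      also have "\<dots> = \<Lambda> t * ((t - card A) * (Suc N choose (t - card A)))"
        using True z by (simp add: col)
      also have "(t - card A) * (Suc N choose (t - card A)) = Suc N * (N choose (t - card A - 1))"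
      proof -
        obtain d where "t - card A = Suc d" using True by (metis Suc_diff_Suc)
        then show ?thesis using binomial_absorption[of d "Suc N"] by (simp only: diff_Suc_1)
      qed
      finally show ?thesis using True by (simp add: z \<kappa>_def algebra_simps)
    qed
  qed
  from fair_share[OF fin(2) finZ zero_less_Suc row' col', of g] obtain b0 where
    b0: "\<And>j. j \<in> J \<Longrightarrow> (\<Sum>z\<in>Z. b0 j z) = \<sigma> j" "\<And>z. z \<in> Z \<Longrightarrow> (\<Sum>j\<in>J. b0 j z) = \<kappa> z"
      "\<And>j z. j \<in> J \<Longrightarrow> z \<in> Z \<Longrightarrow> b0 j z * Suc N < w z * c' j z + Suc N"
      "\<And>j y. j \<in> J \<Longrightarrow> (\<Sum>z | z \<in> Z \<and> g j z = y. b0 j z) * Suc N < (\<Sum>z | z \<in> Z \<and> g j z = y. w z * c' j z) + Suc N"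
    by blast
  define b where "b j t A = (if A \<subseteq> W then b0 j (t, A) else 0)" for j t A
  have bc: "b j t A \<le> c j t A \<and> b j t A \<le> (t - card A) * c j t A" if jt: "j \<in> J" "t \<in> T" for j t A
  proof (cases "A \<subseteq> W")
    case True
    have 1: "b j t A * Suc N < (t - card A) * c j t A + Suc N"
      using b0(3)[of j "(t, A)"] jt True by (simp add: b_def Z_def w_def c'_def)
    show ?thesis
    proof (cases "c j t A = 0 \<or> t - card A = 0")
      case True
      then have "b j t A * Suc N < 1 * Suc N" using 1 by auto
      then have "b j t A < 1" by (simp only: mult_less_cancel2)
      then show ?thesis by simp
    next
      case False
      \<comment> \<open>An edge has at most \<open>Suc N\<close> free places, as otherwise its class
        would be empty. Its share per edge is therefore at most one, and \<open>x\<close> fills at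
        most one place of each edge.\<close>
      have "c j t A \<le> (\<Sum>j\<in>J. c j t A)" using jt fin by (intro member_le_sum) auto
      also have "\<dots> = \<Lambda> t * (Suc N choose (t - card A))" using jt True False by (intro col) auto
      finally have "(Suc N choose (t - card A)) \<noteq> 0" using False by (metis le_zero_eq mult_0_right)
      then have "t - card A \<le> Suc N" by (metis binomial_eq_0 not_le)
      then have "(t - card A) * c j t A \<le> Suc N * c j t A" by (rule mult_right_mono) simp
      then have "b j t A * Suc N < (c j t A + 1) * Suc N" using 1 by (simp add: algebra_simps)
      then have "b j t A < c j t A + 1" by (simp only: mult_less_cancel2)
      then have "b j t A \<le> c j t A" by simp
      moreover have "c j t A \<le> (t - card A) * c j t A" using False by (cases "t - card A") auto
      ultimately show ?thesis by linarith
    qed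
  qed (simp add: b_def)
  have bW: "b j t A = b0 j (t, A)" if "A \<in> Pow W" for j t A using that by (simp add: b_def)
  have bsum: "(\<Sum>t\<in>T. \<Sum>A\<in>Pow W. b j t A) = \<sigma> j" if "j \<in> J" for j
    using b0(1)[OF that] by (simp add: Z_def sum.cartesian_product case_prod_unfold bW)
  have bcol: "(\<Sum>j\<in>J. b j t A) = (if card A < t then \<Lambda> t * (N choose (t - card A - 1)) else 0)"
    if "t \<in> T" "A \<subseteq> W" for t A
    using b0(2)[of "(t, A)"] that by (simp add: Z_def b_def \<kappa>_def)
  have bW0: "b j t A > 0 \<Longrightarrow> A \<subseteq> W" for j t A by (simp add: b_def split: if_splits)
  have blt: "card A < t" if "b j t A > 0" "j \<in> J" "t \<in> T" for j t A
    using bc[of j t A] that by (cases "card A < t") auto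
  let ?c = "\<lambda>j t. split_off x (c j t) (b j t)"
  have notin: "x \<notin> A" "card (insert x A) = Suc (card A)" "insert x A - {x} = A" if "A \<in> Pow W" for A
  proof -
    show *: "x \<notin> A" using that x by auto
    have "finite A" using that fin finite_subset by auto
    then show "card (insert x A) = Suc (card A)" "insert x A - {x} = A" using * by auto
  qed
  have sums: "(\<Sum>t\<in>T. \<Sum>A\<in>Pow (insert x W). f t A * ?c j t A)
      = (\<Sum>t\<in>T. \<Sum>A\<in>Pow W. f t A * (c j t A - b j t A) + f t (insert x A) * b j t A)" for f :: "nat \<Rightarrow> 'a set \<Rightarrow> nat" and j
    using fin x by (auto simp: sum_Pow_insert split_off_def notin intro!: sum.cong)
  have "amalgam T \<Lambda> J \<sigma> N (insert x W) ?c"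
    unfolding amalgam_def
  proof (intro conjI ballI allI impI)
    fix j t A assume jt: "j \<in> J" "t \<in> T" and pos: "?c j t A > 0"
    have "A \<subseteq> insert x W \<and> card A \<le> t"
    proof (cases "x \<in> A")
      case True
      then have p: "b j t (A - {x}) > 0" using pos by (simp add: split_off_def)
      then have "A - {x} \<in> Pow W" using bW0 by auto
      from notin(2)[OF this] True have "card A = Suc (card (A - {x}))" by (simp add: insert_absorb)
      then show ?thesis using blt[OF p jt] bW0[OF p] by auto
    next
      case False
      then have "c j t A > 0" using pos by (simp add: split_off_def)
      then show ?thesis using supp jt by blast
    qed
    then show "A \<subseteq> insert x W" "card A \<le> t" by auto
  next
    fix t A assume t: "t \<in> T" and A: "A \<subseteq> insert x W" "card A \<le> t"
    show "(\<Sum>j\<in>J. ?c j t A) = \<Lambda> t * (N choose (t - card A))"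
    proof (cases "x \<in> A")
      case True
      then have W: "A - {x} \<in> Pow W" using A by auto
      from notin(2)[OF this] True have cA: "card A = Suc (card (A - {x}))" by (simp add: insert_absorb)
      have "(\<Sum>j\<in>J. ?c j t A) = (\<Sum>j\<in>J. b j t (A - {x}))" using True by (simp add: split_off_def)
      then show ?thesis using bcol[OF t, of "A - {x}"] W cA A by auto
    next
      case False
      then have W: "A \<subseteq> W" using A by auto
      have "(\<Sum>j\<in>J. ?c j t A) = (\<Sum>j\<in>J. c j t A) - (\<Sum>j\<in>J. b j t A)"
        using False bc t by (simp add: split_off_def sum_subtractf_nat)
      also have "\<dots> = \<Lambda> t * (Suc N choose (t - card A)) - (if card A < t then \<Lambda> t * (N choose (t - card A - 1)) else 0)"
        by (simp add: col[OF t W A(2)] bcol[OF t W])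
      also have "\<dots> = \<Lambda> t * (N choose (t - card A))"
      proof (cases "card A < t")
        case True
        then obtain d where d: "t - card A = Suc d" by (metis Suc_diff_Suc)
        show ?thesis using True by (simp add: d algebra_simps)
      qed (use A in auto)
      finally show ?thesis .
    qed
  next
    fix j v assume j: "j \<in> J" and v: "v \<in> insert x W"
    have eq: "(\<Sum>t\<in>T. \<Sum>A\<in>Pow (insert x W). of_bool (v \<in> A) * ?c j t A)
      = (\<Sum>t\<in>T. \<Sum>A\<in>Pow W. of_bool (v \<in> A) * (c j t A - b j t A) + of_bool (v \<in> insert x A) * b j t A)"
      using sums[of "\<lambda>t A. of_bool (v \<in> A)" j] by simp
    show "(\<Sum>t\<in>T. \<Sum>A\<in>Pow (insert x W). of_bool (v \<in> A) * ?c j t A) = \<sigma> j"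
    proof (cases "v = x")
      case True
      have "(\<Sum>t\<in>T. \<Sum>A\<in>Pow (insert x W). of_bool (v \<in> A) * ?c j t A) = (\<Sum>t\<in>T. \<Sum>A\<in>Pow W. b j t A)"
        unfolding eq using True notin(1) by (intro sum.cong) auto
      then show ?thesis using bsum[OF j] by simp
    next
      case False
      have "(\<Sum>t\<in>T. \<Sum>A\<in>Pow (insert x W). of_bool (v \<in> A) * ?c j t A) = (\<Sum>t\<in>T. \<Sum>A\<in>Pow W. of_bool (v \<in> A) * c j t A)"
        unfolding eq using False bc j by (intro sum.cong) auto
      then show ?thesis using deg[OF j] False v by simp
    qed
  next
    fix j assume j: "j \<in> J"
    \<comment> \<open>Every edge given to \<open>x\<close> loses one free place. The lost places are
      added on the left to avoid a subtraction of natural numbers.\<close>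
    have "(\<Sum>t\<in>T. \<Sum>A\<in>Pow (insert x W). (t - card A) * ?c j t A) + (\<Sum>t\<in>T. \<Sum>A\<in>Pow W. b j t A)
      = (\<Sum>t\<in>T. \<Sum>A\<in>Pow W. ((t - card A) * (c j t A - b j t A) + (t - card (insert x A)) * b j t A) + b j t A)"
      using sums[of "\<lambda>t A. t - card A" j] by (simp add: sum.distrib)
    also have "\<dots> = (\<Sum>t\<in>T. \<Sum>A\<in>Pow W. (t - card A) * c j t A)"
    proof (intro sum.cong refl)
      fix t A assume t: "t \<in> T" and A: "A \<in> Pow W"
      show "((t - card A) * (c j t A - b j t A) + (t - card (insert x A)) * b j t A) + b j t A = (t - card A) * c j t A"
      proof (cases "b j t A = 0")
        case False
        then have "card A < t" using blt j t by simp
        then obtain d where d: "t = card A + Suc d" using less_imp_Suc_add by (metis add_Suc_right)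
        obtain u where u: "c j t A = b j t A + u" using bc[OF j t] le_Suc_ex by blast
        have e: "t - card A = Suc d" "t - card (insert x A) = d" using notin(2)[OF A] d by auto
        show ?thesis unfolding e u by (simp add: algebra_simps)
      qed simp
    qed
    finally show "(\<Sum>t\<in>T. \<Sum>A\<in>Pow (insert x W). (t - card A) * ?c j t A) = \<sigma> j * N"
      using tot[OF j] bsum[OF j] by simp
  qed
  moreover have "(\<Sum>(t, A) | (t, A) \<in> T \<times> Pow W \<and> g j (t, A) = y. b j t A) * Suc N
       < (\<Sum>(t, A) | (t, A) \<in> T \<times> Pow W \<and> g j (t, A) = y. (t - card A) * c j t A) + Suc N"
    if j: "j \<in> J" for j y
  proof -
    have "(\<Sum>(t, A) | (t, A) \<in> T \<times> Pow W \<and> g j (t, A) = y. b j t A) = (\<Sum>z | z \<in> Z \<and> g j z = y. b0 j z)"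
      by (rule sum.cong) (auto simp: Z_def b_def)
    moreover have "(\<Sum>(t, A) | (t, A) \<in> T \<times> Pow W \<and> g j (t, A) = y. (t - card A) * c j t A)
      = (\<Sum>z | z \<in> Z \<and> g j z = y. w z * c' j z)"
      by (rule sum.cong) (auto simp: Z_def w_def c'_def)
    ultimately show ?thesis using b0(4)[OF j] by simp
  qed
  ultimately show ?thesis using bc bsum by (intro exI[of _ b]) blast
qed

section \<open>Connectedness\<close>

definition trace_adj :: "('a set \<Rightarrow> nat) \<Rightarrow> ('a \<times> 'a) set" where
  "trace_adj c = {(u, v). \<exists>A. c A > 0 \<and> u \<in> A \<and> v \<in> A}"

text \<open>The degree of a block towards the amalgamated vertex: an edge counts once for each of
  its free places. The empty trace is excluded since loops belong to no block.\<close>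

definition out_degree :: "nat \<Rightarrow> ('a set \<Rightarrow> nat) \<Rightarrow> 'a set \<Rightarrow> nat" where
  "out_degree h c C = (\<Sum>A\<in>Pow C - {{}}. (h - card A) * c A)"

text \<open>The blocks are the components of one colour class after deletion of the amalgamated vertex.
  The numerical condition says that there are enough edges for the blocks, the loops counted by
  \<open>c {}\<close> and the \<open>N\<close> vertices still to be separated to end up in a single block; for
  \<open>N = 0\<close> it gives \<open>card B \<le> 1\<close>.\<close>
definition linked_blocks :: "nat \<Rightarrow> nat \<Rightarrow> nat \<Rightarrow> 'a set \<Rightarrow> ('a set \<Rightarrow> nat) \<Rightarrow> 'a set set \<Rightarrow> bool" where
  "linked_blocks h s N W c B \<longleftrightarrow>
     partition_on W B \<and> (\<forall>A. c A > 0 \<longrightarrow> A \<noteq> {} \<longrightarrow> (\<exists>C\<in>B. A \<subseteq> C)) \<and>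
     (N > 0 \<longrightarrow> (\<forall>C\<in>B. 0 < out_degree h c C)) \<and>
     N + card B + c {} \<le> s * N + 1 \<and>
     (\<forall>C\<in>B. \<forall>u\<in>C. \<forall>v\<in>C. (u, v) \<in> (trace_adj c)\<^sup>*)"

text \<open>Blocks with a single outgoing edge share the label \<^const>\<open>None\<close>: a vertex split off with all
  its edges into such blocks would be cut off, and this can only be prevented by bounding
  their joint share.\<close>
definition block_label :: "nat \<Rightarrow> ('a set \<Rightarrow> nat) \<Rightarrow> 'a set set \<Rightarrow> 'a set \<Rightarrow> 'a set option" where
  "block_label h c B A = (if A = {} then Some {} else
     let C = \<Union>{C \<in> B. A \<inter> C \<noteq> {}} in if out_degree h c C = 1 then None else Some C)"

lemma sum_over_blocks:
  fixes f :: "'a set \<Rightarrow> nat"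
  assumes W: "finite W" and B: "partition_on W B"
    and supp: "\<And>A. f A > 0 \<Longrightarrow> A \<noteq> {} \<Longrightarrow> \<exists>C\<in>B. A \<subseteq> C"
  shows "(\<Sum>A\<in>Pow W. f A) = f {} + (\<Sum>C\<in>B. \<Sum>A\<in>Pow C - {{}}. f A)"
proof -
  have un: "\<Union>B = W" using B by (simp add: partition_on_def)
  have finB: "finite B" using B W by (rule finite_elements[rotated])
  have finC: "finite C" if "C \<in> B" for C using un that W by (metis Union_upper finite_subset)
  have "(\<Sum>A\<in>Pow W. f A) = f {} + (\<Sum>A\<in>Pow W - {{}}. f A)"
    using W by (subst sum.remove[of _ "{}"]) auto
  also have "(\<Sum>A\<in>Pow W - {{}}. f A) = (\<Sum>A\<in>(\<Union>C\<in>B. Pow C - {{}}). f A)"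
    using W un supp by (intro sum.mono_neutral_right) auto
  also have "\<dots> = (\<Sum>C\<in>B. \<Sum>A\<in>Pow C - {{}}. f A)"
  proof (rule sum.UNION_disjoint[OF finB])
    show "\<forall>C\<in>B. finite (Pow C - {{}})" using finC by auto
    show "\<forall>C\<in>B. \<forall>C'\<in>B. C \<noteq> C' \<longrightarrow> (Pow C - {{}}) \<inter> (Pow C' - {{}}) = {}"
    proof (intro ballI impI)
      fix C C' assume "C \<in> B" "C' \<in> B" "C \<noteq> C'"
      then have "C \<inter> C' = {}" using B by (auto simp: partition_on_def disjoint_def)
      then show "(Pow C - {{}}) \<inter> (Pow C' - {{}}) = {}" by blast
    qed
  qed
  finally show ?thesis .
qed

text \<open>A nonempty trace in the support lies in one block and meets no other, so the union in
  \<open>block_label\<close> returns this block. Traces of different blocks are mixed only under the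
  label \<open>None\<close>.\<close>

lemma sum_block_label:
  fixes f :: "'a set \<Rightarrow> nat"
  assumes W: "finite W" and B: "partition_on W B"
    and supp: "\<And>A. f A > 0 \<Longrightarrow> A \<noteq> {} \<Longrightarrow> \<exists>C\<in>B. A \<subseteq> C"
  shows "(\<Sum>A | A \<in> Pow W \<and> block_label h c B A = y. f A) = (if y = Some {} then f {} else 0)
    + (\<Sum>C\<in>B. if (if out_degree h c C = 1 then None else Some C) = y then \<Sum>A\<in>Pow C - {{}}. f A else 0)"
proof -
  define f' where "f' A = (if block_label h c B A = y then f A else 0)" for A
  have lab: "\<Union>{C' \<in> B. A \<inter> C' \<noteq> {}} = C" if "A \<subseteq> C" "C \<in> B" "A \<noteq> {}" for A C
  proof -
    have "C' = C" if "C' \<in> B" "A \<inter> C' \<noteq> {}" for C'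
      using B that \<open>A \<subseteq> C\<close> \<open>C \<in> B\<close> by (auto simp: partition_on_def disjoint_def)
    then have "{C' \<in> B. A \<inter> C' \<noteq> {}} = {C}" using that by auto
    then show ?thesis by simp
  qed
  have "(\<Sum>A | A \<in> Pow W \<and> block_label h c B A = y. f A) = (\<Sum>A\<in>Pow W. f' A)"
    using W by (intro sum.mono_neutral_cong_left) (auto simp: f'_def)
  also have "\<dots> = f' {} + (\<Sum>C\<in>B. \<Sum>A\<in>Pow C - {{}}. f' A)"
    by (rule sum_over_blocks[OF W B]) (use supp in \<open>auto simp: f'_def split: if_splits\<close>)
  also have "f' {} = (if y = Some {} then f {} else 0)" by (auto simp: f'_def block_label_def)
  also have "(\<Sum>C\<in>B. \<Sum>A\<in>Pow C - {{}}. f' A)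
    = (\<Sum>C\<in>B. if (if out_degree h c C = 1 then None else Some C) = y then \<Sum>A\<in>Pow C - {{}}. f A else 0)"
  proof (intro sum.cong refl)
    fix C assume C: "C \<in> B"
    have "f' A = (if (if out_degree h c C = 1 then None else Some C) = y then f A else 0)" if "A \<in> Pow C - {{}}" for A
      using lab[of A C] that C by (simp add: f'_def block_label_def)
    then show "(\<Sum>A\<in>Pow C - {{}}. f' A)
      = (if (if out_degree h c C = 1 then None else Some C) = y then \<Sum>A\<in>Pow C - {{}}. f A else 0)"
      by simp
  qed
  finally show ?thesis .
qed

text \<open>The edges given to \<open>x\<close> glue all the blocks they touch into one new block
  \<open>X\<close>. Two things might go wrong: a block that takes several of the \<open>s\<close>
  edges wastes merges and endangers the count, and \<open>X\<close> may be left without a free place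
  although vertices remain. The proportional shares exclude both.\<close>

lemma linked_blocks_step:
  fixes c :: "'a set \<Rightarrow> nat"
  assumes lb: "linked_blocks h s (Suc N) W c B"
    and W: "finite W" and x: "x \<notin> W" and h: "h \<ge> 2"
    and tot: "(\<Sum>A\<in>Pow W. (h - card A) * c A) = s * Suc N"
    and cW: "\<And>A. c A > 0 \<Longrightarrow> A \<subseteq> W"
    and bc: "\<And>A. b A \<le> c A" and bw: "\<And>A. b A \<le> (h - card A) * c A"
    and bs: "(\<Sum>A\<in>Pow W. b A) = s"
    and fair: "\<And>y. (\<Sum>A | A \<in> Pow W \<and> block_label h c B A = y. b A) * Suc N
      < (\<Sum>A | A \<in> Pow W \<and> block_label h c B A = y. (h - card A) * c A) + Suc N"
  shows "\<exists>B'. linked_blocks h s N (insert x W) (split_off x c b) B'"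
proof -
  define D where "D = out_degree h c"
  define \<beta> where "\<beta> C = (\<Sum>A\<in>Pow C - {{}}. b A)" for C
  define T where "T = {C \<in> B. \<beta> C > 0}"
  define X where "X = insert x (\<Union>T)"
  define c' where "c' = split_off x c b"
  define B' where "B' = insert X (B - T)"
  have B: "partition_on W B" and cov: "\<And>A. c A > 0 \<Longrightarrow> A \<noteq> {} \<Longrightarrow> \<exists>C\<in>B. A \<subseteq> C"
    and Dpos: "\<And>C. C \<in> B \<Longrightarrow> 0 < D C"
    and count: "Suc N + card B + c {} \<le> s * Suc N + 1"
    and link: "\<And>C u v. C \<in> B \<Longrightarrow> u \<in> C \<Longrightarrow> v \<in> C \<Longrightarrow> (u, v) \<in> (trace_adj c)\<^sup>*"
    using lb unfolding linked_blocks_def D_def by blast+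
  have un: "\<Union>B = W" and ne: "{} \<notin> B" and disj: "\<And>C C'. C \<in> B \<Longrightarrow> C' \<in> B \<Longrightarrow> C \<noteq> C' \<Longrightarrow> C \<inter> C' = {}"
    using B by (auto simp: partition_on_def disjoint_def)
  have finB: "finite B" using B W by (rule finite_elements[rotated])
  have finC: "finite C" if "C \<in> B" for C using un that W by (metis Union_upper finite_subset)
  have TB: "T \<subseteq> B" and finT: "finite T" using finB by (auto simp: T_def)
  have covb: "\<exists>C\<in>B. A \<subseteq> C" if "b A > 0" "A \<noteq> {}" for A
    using cov[of A] bc[of A] that by auto
  have covw: "\<exists>C\<in>B. A \<subseteq> C" if "(h - card A) * c A > 0" "A \<noteq> {}" for A
    using cov[of A] that by auto
  have label_b: "(\<Sum>A | A \<in> Pow W \<and> block_label h c B A = y. b A) = (if y = Some {} then b {} else 0)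
    + (\<Sum>C\<in>B. if (if out_degree h c C = 1 then None else Some C) = y then \<Sum>A\<in>Pow C - {{}}. b A else 0)" for y
    by (rule sum_block_label[OF W B]) (use covb in auto)
  have label_w: "(\<Sum>A | A \<in> Pow W \<and> block_label h c B A = y. (h - card A) * c A) = (if y = Some {} then (h - card ({} :: 'a set)) * c {} else 0)
    + (\<Sum>C\<in>B. if (if out_degree h c C = 1 then None else Some C) = y then \<Sum>A\<in>Pow C - {{}}. (h - card A) * c A else 0)" for y
    by (rule sum_block_label[OF W B, of "\<lambda>A. (h - card A) * c A"]) (use covw in auto)
  have s_eq: "s = b {} + (\<Sum>C\<in>B. \<beta> C)"
    using sum_over_blocks[OF W B, of b] covb bs by (simp add: \<beta>_def)
  have sM_eq: "s * Suc N = h * c {} + (\<Sum>C\<in>B. D C)"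
    unfolding D_def out_degree_def tot[symmetric]
    by (subst sum_over_blocks[OF W B, of "\<lambda>A. (h - card A) * c A"]) (use covw in auto)
  have fairC: "\<beta> C * Suc N < D C + Suc N" if C: "C \<in> B" "D C \<noteq> 1" for C
  proof -
    have sel: "(\<Sum>C'\<in>B. if (if out_degree h c C' = 1 then None else Some C') = Some C then f C' else 0) = f C" for f :: "'a set \<Rightarrow> nat"
    proof -
      have "(\<Sum>C'\<in>B. if (if out_degree h c C' = 1 then None else Some C') = Some C then f C' else 0)
        = (\<Sum>C'\<in>B. if C' = C then f C' else 0)"
        using C by (intro sum.cong) (auto simp: D_def)
      then show ?thesis using C finB by simp
    qed
    have "(\<Sum>A | A \<in> Pow W \<and> block_label h c B A = Some C. b A) = \<beta> C"
      "(\<Sum>A | A \<in> Pow W \<and> block_label h c B A = Some C. (h - card A) * c A) = D C"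
      unfolding label_b label_w sel \<beta>_def using C ne by (auto simp: D_def out_degree_def)
    then show ?thesis using fair[of "Some C"] by simp
  qed
  have bD: "\<beta> C \<le> D C" for C
    unfolding \<beta>_def D_def out_degree_def by (intro sum_mono bw)
  \<comment> \<open>The new count in disguise: \<open>x\<close> replaces \<open>card T\<close>
    blocks by one and uses up \<open>b {}\<close> loops. If no block takes more than one edge, then
    \<open>s = b {} + card T\<close> and the old count carries over.\<close>
  have key: "Suc N + card B + c {} + s \<le> s * Suc N + 1 + card T + b {}"
  proof (cases "\<forall>C\<in>B. \<beta> C \<le> 1")
    case True
    have "(\<Sum>C\<in>B. \<beta> C) = (\<Sum>C\<in>B. of_bool (C \<in> T))"
      using True by (intro sum.cong refl) (auto simp: T_def of_bool_def le_Suc_eq)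
    also have "\<dots> = card T" using TB finB by (simp add: Int_absorb1 Int_commute)
    finally show ?thesis using s_eq count by simp
  next
    case False
    then obtain C0 where C0: "C0 \<in> B" "\<beta> C0 \<ge> 2" by (auto simp: not_le)
    \<comment> \<open>Two or more edges are taken only from a block with more than
      \<open>Suc N\<close> free places. Its large degree pays for the summand \<open>Suc N\<close>,
      while by \<open>one\<close> every other block pays for itself out of the total degree.\<close>
    have big: "Suc N + \<beta> C0 \<le> D C0 + 1"
    proof -
      obtain d where d: "\<beta> C0 = d + 2" using C0 le_Suc_ex by (metis add.commute)
      have "D C0 \<noteq> 1" using bD[of C0] C0 by simp
      from fairC[OF C0(1) this] have "(d + 2) * Suc N < D C0 + Suc N" by (simp only: d)
      then have "d * Suc N + Suc N < D C0" by (simp add: algebra_simps)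
      then show ?thesis unfolding d by (simp add: algebra_simps)
    qed
    have one: "1 + \<beta> C \<le> D C + of_bool (C \<in> T)" if "C \<in> B" for C
      using that Dpos[OF that] bD[of C] by (auto simp: T_def)
    have "(\<Sum>C\<in>B - {C0}. 1 + \<beta> C) \<le> (\<Sum>C\<in>B - {C0}. D C + of_bool (C \<in> T))"
      by (rule sum_mono) (use one in auto)
    moreover have "(\<Sum>C\<in>B - {C0}. 1 + \<beta> C) + (1 + \<beta> C0) = card B + (\<Sum>C\<in>B. \<beta> C)"
      using sum.remove[OF finB C0(1), of "\<lambda>C. 1 + \<beta> C"] by (simp add: sum_Suc)
    moreover have "(\<Sum>C\<in>B - {C0}. D C + of_bool (C \<in> T)) + (D C0 + 1) = (\<Sum>C\<in>B. D C) + card T"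
    proof -
      have "C0 \<in> T" using C0 by (simp add: T_def)
      moreover have "(\<Sum>C\<in>B. of_bool (C \<in> T)) = card T" using TB finB by (simp add: Int_absorb1 Int_commute)
      ultimately show ?thesis
        using sum.remove[OF finB C0(1), of "\<lambda>C. D C + of_bool (C \<in> T)"] by (simp add: sum.distrib)
    qed
    moreover have "c {} \<le> h * c {}" using h by simp
    ultimately show ?thesis using s_eq sM_eq big by linarith
  qed
  have xC: "x \<notin> C" if "C \<in> B" for C using that un x by auto
  have touched: "C \<in> T" if "b A > 0" "A \<noteq> {}" "A \<subseteq> C" "C \<in> B" for A C
  proof -
    have "b A \<le> \<beta> C" unfolding \<beta>_def using that finC by (intro member_le_sum) auto
    then show ?thesis using that by (simp add: T_def)
  qed
  have toX: "insert x A \<subseteq> X" if "b A > 0" for A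
    using covb[OF that] touched[OF that] by (cases "A = {}") (auto simp: X_def)
  have c'0: "c' A = c A - b A" if "x \<notin> A" for A using that by (simp add: c'_def split_off_def)
  have c'1: "c' (insert x A) = b A" if "x \<notin> A" for A using that by (simp add: c'_def split_off_def)
  have xA: "x \<notin> A" if "c A > 0" for A using cW[OF that] x by auto
  have XB: "X \<notin> B - T" using xC by (auto simp: X_def)
  have cardB': "card B' + card T = card B + 1"
    using XB finB TB card_mono[OF finB TB] finT by (simp add: B'_def card_Diff_subset)
  have part: "partition_on (insert x W) B'"
  proof (rule partition_onI)
    show "\<Union>B' = insert x W" using un TB by (auto simp: B'_def X_def)
    show "{} \<notin> B'" using ne by (auto simp: B'_def X_def)
    fix p q assume "p \<in> B'" "q \<in> B'" "p \<noteq> q"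
    have XC: "X \<inter> C = {}" if "C \<in> B - T" for C
      using that disj[of _ C] TB xC[of C] by (auto simp: X_def)
    show "disjnt p q" using \<open>p \<in> B'\<close> \<open>q \<in> B'\<close> \<open>p \<noteq> q\<close> XC[of p] XC[of q] disj[of p q]
      by (auto simp: B'_def disjnt_def)
  qed
  have cover: "\<exists>C\<in>B'. A \<subseteq> C" if A: "c' A > 0" "A \<noteq> {}" for A
  proof (cases "x \<in> A")
    case True
    then have "b (A - {x}) > 0" using A by (simp add: c'_def split_off_def)
    from toX[OF this] show ?thesis by (auto simp: B'_def)
  next
    case False
    then have "c A > 0" using A c'0[of A] by simp
    then obtain C where "C \<in> B" "A \<subseteq> C" using cov A by blast
    then show ?thesis by (cases "C \<in> T") (auto simp: B'_def X_def)
  qed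
  have num: "N + card B' + c' {} \<le> s * N + 1"
    using key cardB' c'0[of "{}"] bc[of "{}"] by simp
  have sub: "trace_adj c \<subseteq> trace_adj c'"
  proof
    fix p assume "p \<in> trace_adj c"
    then obtain u v A where p: "p = (u, v)" "c A > 0" "u \<in> A" "v \<in> A" by (auto simp: trace_adj_def)
    have "c' A > 0 \<or> c' (insert x A) > 0" using c'0[OF xA] c'1[OF xA] p by (cases "b A = 0") auto
    then show "p \<in> trace_adj c'" using p by (auto simp: trace_adj_def)
  qed
  have sym: "sym ((trace_adj c')\<^sup>*)" by (intro sym_rtrancl) (auto simp: sym_def trace_adj_def)
  have toX': "(u, x) \<in> (trace_adj c')\<^sup>*" if uX: "u \<in> X" for u
  proof (cases "u = x")
    case False
    then obtain C where C: "C \<in> T" "u \<in> C" using uX by (auto simp: X_def)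
    then have "\<beta> C > 0" "C \<in> B" by (auto simp: T_def)
    have "\<exists>A\<in>Pow C - {{}}. b A \<noteq> 0"
    proof (rule ccontr)
      assume "\<not> ?thesis"
      then have "\<beta> C = 0" unfolding \<beta>_def by (intro sum.neutral) simp
      then show False using \<open>\<beta> C > 0\<close> by simp
    qed
    then obtain A where A: "A \<subseteq> C" "A \<noteq> {}" "b A > 0" by auto
    then obtain a where a: "a \<in> A" by auto
    have "u \<in> C" "a \<in> C" using C a A by auto
    then have "(u, a) \<in> (trace_adj c')\<^sup>*"
      by (rule subsetD[OF rtrancl_mono[OF sub] link[OF \<open>C \<in> B\<close>]])
    moreover have "(a, x) \<in> trace_adj c'"
    proof -
      have "x \<notin> A" using A xC[OF \<open>C \<in> B\<close>] by auto
      then have "c' (insert x A) > 0" using c'1 A by simp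
      then show ?thesis using a unfolding trace_adj_def by blast
    qed
    ultimately show ?thesis by (rule rtrancl_into_rtrancl)
  qed simp
  have linked: "(u, v) \<in> (trace_adj c')\<^sup>*" if "C \<in> B'" "u \<in> C" "v \<in> C" for C u v
  proof (cases "C = X")
    case True
    have "(x, v) \<in> (trace_adj c')\<^sup>*" using symD[OF sym toX'[of v]] that True by simp
    moreover have "(u, x) \<in> (trace_adj c')\<^sup>*" using toX'[of u] that True by simp
    ultimately show ?thesis by (rule rtrancl_trans[rotated])
  next
    case False
    then have "C \<in> B" using that by (auto simp: B'_def)
    from link[OF this that(2,3)] show ?thesis by (rule subsetD[OF rtrancl_mono[OF sub]])
  qed
  have out: "0 < out_degree h c' C" if N: "N > 0" and C: "C \<in> B'" for C
  proof (cases "C = X")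
    case False
    then have CB: "C \<in> B" "\<beta> C = 0" using C by (auto simp: B'_def T_def)
    have "c' A = c A" if "A \<in> Pow C - {{}}" for A
    proof -
      have "b A = 0" using CB that finC[OF CB(1)] by (auto simp: \<beta>_def)
      moreover have "x \<notin> A" using that xC[OF CB(1)] by auto
      ultimately show ?thesis using c'0 by simp
    qed
    then have "out_degree h c' C = D C" by (simp add: D_def out_degree_def)
    then show ?thesis using Dpos CB by simp
  next
    case True
    show ?thesis
    proof (rule ccontr)
      \<comment> \<open>If \<open>X\<close> has no free place, each edge given to \<open>x\<close>
        gave its last one, and each touched block gave all it had. As \<open>N > 0\<close>, a
        proportional share permits this only for blocks with a single free place.\<close>
      assume "\<not> ?thesis"
      moreover have "finite X" using finT TB finC by (auto simp: X_def)
      ultimately have zero: "(h - card A) * c' A = 0" if "A \<subseteq> X" "A \<noteq> {}" for A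
        using that True by (auto simp: out_degree_def)
      have hA: "h \<le> card A + 1" if "b A > 0" for A
      proof -
        have cA: "c A > 0" using that bc[of A] by simp
        then have "finite A" using cW W finite_subset by blast
        then have "card (insert x A) = card A + 1" using xA[OF cA] by simp
        then show ?thesis using zero[OF toX[OF that]] c'1[OF xA[OF cA]] that by auto
      qed
      have b0: "b {} = 0" using hA[of "{}"] h by (cases "b {} = 0") auto
      have leaf: "D C = 1" if C: "C \<in> T" for C
      proof (rule ccontr)
        assume n1: "D C \<noteq> 1"
        have CB: "C \<in> B" using C TB by auto
        have "\<beta> C = D C"
          unfolding \<beta>_def D_def out_degree_def
        proof (intro sum.cong refl)
          fix A assume A: "A \<in> Pow C - {{}}"
          then have "(h - card A) * c' A = 0" using C by (intro zero) (auto simp: X_def)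
          moreover have "x \<notin> A" using A xC[OF CB] by auto
          ultimately have z: "(h - card A) * (c A - b A) = 0" using c'0 by metis
          show "b A = (h - card A) * c A"
          proof (cases "b A = 0")
            case True
            then show ?thesis using z by simp
          next
            case False
            then have "h - card A \<noteq> 0" using bw[of A] by (metis le_zero_eq mult_0)
            then have "h - card A = 1" "c A \<le> b A" using hA[of A] False z by auto
            then show ?thesis using bc[of A] by simp
          qed
        qed
        then have "D C * Suc N < D C + Suc N" using fairC[OF CB n1] by simp
        moreover obtain d where "D C = d + 2"
        proof -
          have "2 \<le> D C" using Dpos[OF CB] n1 by simp
          then show "(\<And>d. D C = d + 2 \<Longrightarrow> thesis) \<Longrightarrow> thesis" for thesis by (metis le_Suc_ex add.commute)
        qed
        moreover obtain e where "N = e + 1" using N by (metis Suc_eq_plus1 gr0_implies_Suc)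
        ultimately show False by simp
      qed
      define L where "L = {C \<in> B. D C = 1}"
      have TL: "T \<subseteq> L" using leaf TB by (auto simp: L_def)
      have finL: "finite L" using finB by (simp add: L_def)
      have sumL: "(\<Sum>C\<in>B. if (if out_degree h c C = 1 then None else Some C) = None then f C else 0) = (\<Sum>C\<in>L. f C)"
        for f :: "'a set \<Rightarrow> nat"
        using finB by (intro sum.mono_neutral_cong_right) (auto simp: L_def D_def)
      \<comment> \<open>All \<open>s\<close> edges at \<open>x\<close> now come from blocks of
        out-degree one; the group labelled \<open>None\<close> bounds their joint share.\<close>
      have "(\<Sum>C\<in>L. \<beta> C) * Suc N < (\<Sum>C\<in>L. D C) + Suc N"
      proof -
        have "(\<Sum>A | A \<in> Pow W \<and> block_label h c B A = None. b A) = (\<Sum>C\<in>L. \<beta> C)"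
          unfolding label_b sumL \<beta>_def by simp
        moreover have "(\<Sum>A | A \<in> Pow W \<and> block_label h c B A = None. (h - card A) * c A) = (\<Sum>C\<in>L. D C)"
          unfolding label_w sumL by (simp add: D_def out_degree_def)
        ultimately show ?thesis using fair[of None] by simp
      qed
      moreover have "(\<Sum>C\<in>L. \<beta> C) = s"
      proof -
        have "(\<Sum>C\<in>B. \<beta> C) = (\<Sum>C\<in>L. \<beta> C)"
          using finB TL by (intro sum.mono_neutral_right) (auto simp: L_def T_def)
        then show ?thesis using s_eq b0 by simp
      qed
      moreover have "(\<Sum>C\<in>L. D C) = card L" by (simp add: L_def)
      ultimately have few: "s * Suc N < card L + Suc N" by simp
      have LB: "card L \<le> card B" using finB by (intro card_mono) (auto simp: L_def)
      \<comment> \<open>By \<open>few\<close> and \<open>count\<close> only the extremal case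
        remains: no loops, and every block of out-degree one. Then the total degree is
        \<open>s * Suc N = card B\<close>, and \<open>count\<close> forces
        \<open>N = 0\<close>.\<close>
      show False
      proof (cases "card B + c {} = card L")
        case False
        then show False using few count LB by linarith
      next
        case True
        then have "c {} = 0" "card L = card B" using LB by auto
        then have "L = B" using finB by (intro card_subset_eq) (auto simp: L_def)
        then have "s * Suc N = card B" using sM_eq \<open>c {} = 0\<close> \<open>(\<Sum>C\<in>L. D C) = card L\<close> by simp
        then show False using count \<open>c {} = 0\<close> N by simp
      qed
    qed
  qed
  have "linked_blocks h s N (insert x W) c' B'"
    unfolding linked_blocks_def
    by (intro conjI allI impI ballI part num) (use cover out linked in auto)
  then show ?thesis unfolding c'_def by blast
qed

lemma separate_vertices:
  assumes "finite X" "amalgam T \<Lambda> J \<sigma> N M c" "finite T" "finite J" "finite M" "X \<inter> M = {}" "card X \<le> N"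
  shows "\<exists>c'. amalgam T \<Lambda> J \<sigma> (N - card X) (X \<union> M) c'"
  using assms(1,6,7)
proof (induction X rule: finite_induct)
  case empty
  then show ?case using assms(2) by auto
next
  case (insert x X)
  then obtain c' where c': "amalgam T \<Lambda> J \<sigma> (N - card X) (X \<union> M) c'" by auto
  have eq: "N - card X = Suc (N - card (insert x X))" using insert by simp
  \<comment> \<open>A constant labelling makes all cells of a colour one group, which asks for
    nothing beyond the colour total.\<close>
  from amalgam_step[OF c'[unfolded eq] assms(3,4), of x "\<lambda>_ _. ()"] show ?case
    using insert assms(5) by auto
qed

text \<open>The given factors survive the detachment because an edge with \<open>h\<close> vertices
  in \<open>M\<close> has no free place: the bound \<open>b \<le> (h - card A) * c\<close> keeps it
  from being given to a new vertex.\<close>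

lemma separate_vertices_linked:
  assumes "finite X" "amalgam {h} \<Lambda> J (\<lambda>_. s) N M c" "finite J" "finite M" "X \<inter> M = {}" "card X \<le> N"
    and h: "h \<ge> 2" and "\<forall>j\<in>J. \<exists>B. linked_blocks h s N M (c j h) B"
  shows "\<exists>c'. amalgam {h} \<Lambda> J (\<lambda>_. s) (N - card X) (X \<union> M) c' \<and>
    (\<forall>j\<in>J. \<exists>B. linked_blocks h s (N - card X) (X \<union> M) (c' j h) B) \<and>
    (\<forall>j\<in>J. \<forall>A. A \<subseteq> M \<longrightarrow> card A = h \<longrightarrow> c' j h A = c j h A)"
  using assms(1,5,6)
proof (induction X rule: finite_induct)
  case empty
  then show ?case using assms(2,8) by auto
next
  case (insert x X)
  let ?N = "N - card (insert x X)" and ?W = "X \<union> M"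
  have eq: "N - card X = Suc ?N" using insert by simp
  from insert obtain c' where am: "amalgam {h} \<Lambda> J (\<lambda>_. s) (Suc ?N) ?W c'"
    and "\<forall>j\<in>J. \<exists>B. linked_blocks h s (Suc ?N) ?W (c' j h) B"
    and keep: "\<And>j A. j \<in> J \<Longrightarrow> A \<subseteq> M \<Longrightarrow> card A = h \<Longrightarrow> c' j h A = c j h A" by (auto simp: eq)
  then obtain B where B: "\<And>j. j \<in> J \<Longrightarrow> linked_blocks h s (Suc ?N) ?W (c' j h) (B j)" by metis
  have W: "finite ?W" "x \<notin> ?W" using insert assms(4) by auto
  define g where "g j = (\<lambda>(t::nat, A). block_label h (c' j h) (B j) A)" for j
  from amalgam_step[OF am _ assms(3) W, of g] obtain b where
    am': "amalgam {h} \<Lambda> J (\<lambda>_. s) ?N (insert x ?W) (\<lambda>j t. split_off x (c' j t) (b j t))"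
    and bc: "\<And>j A. j \<in> J \<Longrightarrow> b j h A \<le> c' j h A" "\<And>j A. j \<in> J \<Longrightarrow> b j h A \<le> (h - card A) * c' j h A"
    and bs: "\<And>j. j \<in> J \<Longrightarrow> (\<Sum>A\<in>Pow ?W. b j h A) = s"
    and fair: "\<And>j y. j \<in> J \<Longrightarrow> (\<Sum>(t, A) | (t, A) \<in> {h} \<times> Pow ?W \<and> g j (t, A) = y. b j t A) * Suc ?N
       < (\<Sum>(t, A) | (t, A) \<in> {h} \<times> Pow ?W \<and> g j (t, A) = y. (t - card A) * c' j t A) + Suc ?N"
    by (simp del: mult_Suc_right insert_iff Un_insert_left) blast
  have single: "(\<Sum>(t, A) | (t, A) \<in> {h} \<times> Pow ?W \<and> g j (t, A) = y. f t A)
      = (\<Sum>A | A \<in> Pow ?W \<and> block_label h (c' j h) (B j) A = y. f h A)" for f :: "nat \<Rightarrow> 'a set \<Rightarrow> nat" and j y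
    by (rule sum.reindex_bij_witness[of _ "\<lambda>A. (h, A)" snd]) (auto simp: g_def)
  have "\<exists>B'. linked_blocks h s ?N (insert x ?W) (split_off x (c' j h) (b j h)) B'" if j: "j \<in> J" for j
  proof (rule linked_blocks_step[OF B[OF j] W h])
    show "(\<Sum>A\<in>Pow ?W. (h - card A) * c' j h A) = s * Suc ?N"
      using am j by (simp add: amalgam_def del: mult_Suc_right)
    show "\<And>A. 0 < c' j h A \<Longrightarrow> A \<subseteq> ?W" using am j by (simp add: amalgam_def)
    show "\<And>y. (\<Sum>A | A \<in> Pow ?W \<and> block_label h (c' j h) (B j) A = y. b j h A) * Suc ?N
      < (\<Sum>A | A \<in> Pow ?W \<and> block_label h (c' j h) (B j) A = y. (h - card A) * c' j h A) + Suc ?N"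
      using fair[OF j] unfolding single .
  qed (use bc bs j in auto)
  moreover have "split_off x (c' j h) (b j h) A = c j h A" if "j \<in> J" "A \<subseteq> M" "card A = h" for j A
  proof -
    have "x \<notin> A" "b j h A = 0" using bc(2)[of j A] insert that by auto
    then show ?thesis using keep[OF that] by (simp add: split_off_def)
  qed
  ultimately show ?case using am'
    by (intro exI[of _ "\<lambda>j t. split_off x (c' j t) (b j t)"]) auto
qed

section \<open>Numbers of edges of each colour\<close>

text \<open>Here the amalgamated vertex is \<open>M\<close> itself and the free places of an edge of
  type \<open>t\<close> are its \<open>t\<close> places in \<open>M\<close>; its other places are
  not modelled. Several types run together because a vertex has its degree prescribed only for the
  sum over all types.\<close>

lemma distribute_types:
  fixes M :: "'a set" and e :: "'j \<Rightarrow> nat \<Rightarrow> nat"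
  assumes fin: "finite M" "finite T" "finite J"
    and col: "\<And>t. t \<in> T \<Longrightarrow> (\<Sum>j\<in>J. e j t) = \<Lambda> t * (card M choose t)"
    and row: "\<And>j. j \<in> J \<Longrightarrow> (\<Sum>t\<in>T. t * e j t) = \<sigma> j * card M"
  shows "\<exists>d. (\<forall>j\<in>J. \<forall>A. d j A > 0 \<longrightarrow> A \<subseteq> M \<and> card A \<in> T) \<and>
    (\<forall>A. A \<subseteq> M \<longrightarrow> card A \<in> T \<longrightarrow> (\<Sum>j\<in>J. d j A) = \<Lambda> (card A)) \<and>
    (\<forall>j\<in>J. \<forall>v\<in>M. (\<Sum>A\<in>Pow M. of_bool (v \<in> A) * d j A) = \<sigma> j)"
proof -
  have "amalgam T \<Lambda> J \<sigma> (card M) {} (\<lambda>j t A. if A = {} then e j t else 0)"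
    unfolding amalgam_def using col row by auto
  from separate_vertices[OF fin(1) this fin(2,3)] obtain c where c: "amalgam T \<Lambda> J \<sigma> 0 M c" by auto
  then have supp: "A \<subseteq> M" "card A \<le> t" if "j \<in> J" "t \<in> T" "c j t A > 0" for j t A
    using that unfolding amalgam_def by blast+
  have c0: "(\<Sum>j\<in>J. c j t A) = \<Lambda> t * (0 choose (t - card A))" if "t \<in> T" "A \<subseteq> M" "card A \<le> t" for t A
    using that c unfolding amalgam_def by blast
  have deg: "(\<Sum>t\<in>T. \<Sum>A\<in>Pow M. of_bool (v \<in> A) * c j t A) = \<sigma> j" if "j \<in> J" "v \<in> M" for j v
    using that c unfolding amalgam_def by blast
  \<comment> \<open>Once no vertex remains, the factor \<open>0 choose (t - card A)\<close> vanishes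
    unless all places are filled.\<close>
  have exact: "c j t A = 0" if "j \<in> J" "t \<in> T" "t \<noteq> card A" for j t A
  proof (rule ccontr)
    assume "c j t A \<noteq> 0"
    then have "A \<subseteq> M" "card A < t" using supp[OF that(1,2), of A] that(3) by auto
    then have "(\<Sum>j\<in>J. c j t A) = 0" using c0[of t A] that by (simp add: binomial_eq_0)
    then show False using \<open>c j t A \<noteq> 0\<close> that fin by simp
  qed
  define d where "d j A = (if card A \<in> T then c j (card A) A else 0)" for j A
  have "(\<Sum>A\<in>Pow M. of_bool (v \<in> A) * d j A) = \<sigma> j" if "j \<in> J" "v \<in> M" for j v
  proof -
    have "(\<Sum>t\<in>T. of_bool (v \<in> A) * c j t A) = of_bool (v \<in> A) * d j A" for A
    proof -
      have "(\<Sum>t\<in>T. of_bool (v \<in> A) * c j t A) = (\<Sum>t\<in>T. if t = card A then of_bool (v \<in> A) * d j A else 0)"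
        using exact[OF that(1)] by (intro sum.cong refl) (auto simp: d_def)
      then show ?thesis using fin by (auto simp: d_def)
    qed
    then show ?thesis using deg[OF that] by (subst (asm) sum.swap) simp
  qed
  moreover have "(\<Sum>j\<in>J. d j A) = \<Lambda> (card A)" if "A \<subseteq> M" "card A \<in> T" for A
    using c0[OF that(2,1)] that by (simp add: d_def)
  moreover have "A \<subseteq> M \<and> card A \<in> T" if "j \<in> J" "d j A > 0" for j A
    using that supp[of j "card A" A] by (auto simp: d_def split: if_splits)
  ultimately show ?thesis by (intro exI[of _ d]) blast
qed

lemma greedy_packing:
  fixes n :: "nat \<Rightarrow> nat" and cap :: "'j \<Rightarrow> nat"
  assumes fin: "finite T" "finite J" and sz: "\<And>t. t \<in> T \<Longrightarrow> 0 < t \<and> t \<le> Suc K"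
    and "(\<Sum>t\<in>T. t * n t) + K * card J \<le> (\<Sum>j\<in>J. cap j)"
  shows "\<exists>e. (\<forall>t\<in>T. (\<Sum>j\<in>J. e j t) = n t) \<and> (\<forall>j\<in>J. (\<Sum>t\<in>T. t * e j t) \<le> cap j)"
  using assms(4)
proof (induction "\<Sum>t\<in>T. n t" arbitrary: n)
  case 0
  then have "\<forall>t\<in>T. n t = 0" using fin by simp
  then show ?case by (intro exI[of _ "\<lambda>_ _. 0"]) auto
next
  case (Suc a)
  then obtain t0 where t0: "t0 \<in> T" "n t0 > 0"
    by (metis gr0I sum.neutral Zero_not_Suc)
  define n' where "n' = n(t0 := n t0 - 1)"
  have upd: "(\<Sum>t\<in>T. f t * n t) = (\<Sum>t\<in>T. f t * n' t) + f t0" for f :: "nat \<Rightarrow> nat"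
  proof -
    have "(\<Sum>t\<in>T. f t * n t) = (\<Sum>t\<in>T. f t * n' t + (if t = t0 then f t0 else 0))"
      using t0 by (intro sum.cong refl) (auto simp: n'_def algebra_simps)
    then show ?thesis using t0 fin by (simp add: sum.distrib)
  qed
  have "a = (\<Sum>t\<in>T. n' t)" using upd[of "\<lambda>_. 1"] Suc(2) by simp
  moreover have "(\<Sum>t\<in>T. t * n' t) + K * card J \<le> (\<Sum>j\<in>J. cap j)" using upd[of id] Suc by simp
  ultimately obtain e where e: "\<And>t. t \<in> T \<Longrightarrow> (\<Sum>j\<in>J. e j t) = n' t" "\<And>j. j \<in> J \<Longrightarrow> (\<Sum>t\<in>T. t * e j t) \<le> cap j"
    using Suc(1)[of n'] by blast
  have "\<exists>j\<in>J. (\<Sum>t\<in>T. t * e j t) + t0 \<le> cap j"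
  proof (rule ccontr)
    assume "\<not> ?thesis"
    \<comment> \<open>If the item of size \<open>t0\<close> fits nowhere, every bin has at most
      \<open>K\<close> free places, so the capacity is at most the load of the other items plus
      \<open>K * card J\<close>. The hypothesis leaves room for \<open>t0\<close> more.\<close>
    then have "(\<Sum>j\<in>J. cap j) \<le> (\<Sum>j\<in>J. (\<Sum>t\<in>T. t * e j t) + K)"
      using sz[OF t0(1)] by (intro sum_mono) (force simp: not_le)
    also have "\<dots> = (\<Sum>t\<in>T. t * n' t) + K * card J"
      by (subst sum.distrib, subst sum.swap) (simp add: e(1) flip: sum_distrib_left)
    finally show False using upd[of id] Suc(3) sz[OF t0(1)] by simp
  qed
  then obtain j0 where j0: "j0 \<in> J" "(\<Sum>t\<in>T. t * e j0 t) + t0 \<le> cap j0" by blast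
  define e' where "e' j t = e j t + (if j = j0 \<and> t = t0 then 1 else 0)" for j t
  have "(\<Sum>j\<in>J. e' j t) = n t" if "t \<in> T" for t
    using e(1)[OF that] j0 t0 fin by (cases "t = t0") (auto simp: e'_def sum.distrib n'_def)
  moreover have "(\<Sum>t\<in>T. t * e' j t) \<le> cap j" if "j \<in> J" for j
  proof (cases "j = j0")
    case True
    have "(\<Sum>t\<in>T. t * e' j t) = (\<Sum>t\<in>T. t * e j t + (if t = t0 then t0 else 0))"
      using True by (intro sum.cong) (auto simp: e'_def algebra_simps)
    also have "\<dots> = (\<Sum>t\<in>T. t * e j t) + t0" using fin t0 by (simp add: sum.distrib)
    finally show ?thesis using j0 True by simp
  qed (use e(2)[OF that] in \<open>simp add: e'_def\<close>)
  ultimately show ?case by (intro exI[of _ e']) blast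
qed

text \<open>The large items are packed greedily, at most \<open>K\<close> places being lost in each bin when no
  further one fits; the items of size one then fill the bins.\<close>
lemma exact_packing:
  fixes n :: "nat \<Rightarrow> nat" and cap :: "'j \<Rightarrow> nat"
  assumes fin: "finite T" "finite J" and sz: "\<And>t. t \<in> T \<Longrightarrow> 0 < t \<and> t \<le> Suc K" and one: "1 \<in> T"
    and tot: "(\<Sum>t\<in>T. t * n t) = (\<Sum>j\<in>J. cap j)" and many: "K * card J \<le> n 1"
  shows "\<exists>e. (\<forall>t\<in>T. (\<Sum>j\<in>J. e j t) = n t) \<and> (\<forall>j\<in>J. (\<Sum>t\<in>T. t * e j t) = cap j)"
proof -
  let ?T = "T - {1}"
  have T: "(\<Sum>t\<in>T. t * f t) = f 1 + (\<Sum>t\<in>?T. t * f t)" for f :: "nat \<Rightarrow> nat"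
    using sum.remove[OF fin(1) one, of "\<lambda>t. t * f t"] by simp
  have "(\<Sum>t\<in>?T. t * n t) + K * card J \<le> (\<Sum>j\<in>J. cap j)" using tot many T[of n] by simp
  then obtain e where e: "\<And>t. t \<in> ?T \<Longrightarrow> (\<Sum>j\<in>J. e j t) = n t" "\<And>j. j \<in> J \<Longrightarrow> (\<Sum>t\<in>?T. t * e j t) \<le> cap j"
    using greedy_packing[of ?T J K n cap] fin sz by auto
  define e' where "e' j t = (if t = 1 then cap j - (\<Sum>t\<in>?T. t * e j t) else e j t)" for j t
  have big: "(\<Sum>t\<in>?T. t * e' j t) = (\<Sum>t\<in>?T. t * e j t)" for j
    by (intro sum.cong) (auto simp: e'_def)
  have "(\<Sum>j\<in>J. e' j 1) = n 1"
  proof -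
    have "(\<Sum>j\<in>J. e' j 1) = (\<Sum>j\<in>J. cap j) - (\<Sum>j\<in>J. \<Sum>t\<in>?T. t * e j t)"
      unfolding e'_def using e(2) by (simp add: sum_subtractf_nat)
    also have "(\<Sum>j\<in>J. \<Sum>t\<in>?T. t * e j t) = (\<Sum>t\<in>?T. t * n t)"
      by (subst sum.swap) (simp add: e(1) flip: sum_distrib_left)
    finally show ?thesis using tot T[of n] by simp
  qed
  moreover have "(\<Sum>j\<in>J. e' j t) = n t" if "t \<in> ?T" for t using e(1)[OF that] that by (simp add: e'_def)
  moreover have "(\<Sum>t\<in>T. t * e' j t) = cap j" if "j \<in> J" for j
    using e(2)[OF that] unfolding T big by (simp add: e'_def)
  ultimately show ?thesis by (intro exI[of _ e']) blast
qed

section \<open>Incidence counts, a binomial estimate and the initial blocks\<close>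

lemma sum_incidences:
  fixes f :: "'a set \<Rightarrow> nat"
  assumes "finite W"
  shows "(\<Sum>v\<in>W. \<Sum>A\<in>Pow W. of_bool (v \<in> A) * f A) = (\<Sum>A\<in>Pow W. card A * f A)"
proof -
  have "(\<Sum>v\<in>W. of_bool (v \<in> A) * f A) = card A * f A" if "A \<in> Pow W" for A
    using that assms by (simp add: Int_absorb1 flip: sum_distrib_right)
  then show ?thesis by (subst sum.swap) simp
qed

lemma sum_Pow_by_card:
  fixes g :: "nat \<Rightarrow> nat"
  assumes "finite W" "finite T"
  shows "(\<Sum>A\<in>Pow W. if card A \<in> T then g (card A) else 0) = (\<Sum>t\<in>T. (card W choose t) * g t)"
proof -
  have "(\<Sum>A\<in>Pow W. if card A \<in> T then g (card A) else 0) = (\<Sum>A | A \<in> Pow W \<and> card A \<in> T. g (card A))"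
    using assms by (intro sum.mono_neutral_cong_right) auto
  also have "\<dots> = (\<Sum>t\<in>T. \<Sum>A | A \<in> {A \<in> Pow W. card A \<in> T} \<and> card A = t. g (card A))"
    by (rule sum.group[symmetric]) (use assms in auto)
  also have "\<dots> = (\<Sum>t\<in>T. (card W choose t) * g t)"
  proof (intro sum.cong refl)
    fix t assume t: "t \<in> T"
    have "(\<Sum>A | A \<in> {A \<in> Pow W. card A \<in> T} \<and> card A = t. g (card A)) = (\<Sum>A | A \<subseteq> W \<and> card A = t. g t)"
      using t by (intro sum.cong) auto
    then show "(\<Sum>A | A \<in> {A \<in> Pow W. card A \<in> T} \<and> card A = t. g (card A)) = (card W choose t) * g t"
      using n_subsets[OF assms(1)] by simp
  qed
  finally show ?thesis .
qed

text \<open>Each factor of the falling factorial grows by at most 5/4, and the fourth power of that,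
  625/256, is below 4. The lemma bounds all edges at a vertex of \<open>M\<close> by those that meet
  \<open>M\<close> nowhere else.\<close>

lemma binomial_4_growth:
  assumes "N \<ge> 4 * m" "N \<ge> 4"
  shows "((m + N - 1) choose 4) \<le> 4 * (N choose 4)"
proof -
  have fall: "24 * (k choose 4) = k * (k - 1) * (k - 2) * (k - 3)" for k :: nat
  proof -
    have 4: "4 * (k choose 4) = k * ((k - 1) choose 3)"
      using binomial_absorption[of 3 k] by simp
    have 3: "3 * ((k - 1) choose 3) = (k - 1) * ((k - 2) choose 2)"
      using binomial_absorption[of 2 "k - 1"] by (simp add: numeral_eq_Suc)
    have 2: "2 * ((k - 2) choose 2) = (k - 2) * (k - 3)"
      using binomial_absorption[of 1 "k - 2"] by (simp add: numeral_eq_Suc)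
    have "24 * (k choose 4) = 6 * (k * ((k - 1) choose 3))" unfolding 4[symmetric] by simp
    also have "\<dots> = 2 * k * ((k - 1) * ((k - 2) choose 2))" unfolding 3[symmetric] by simp
    also have "\<dots> = k * (k - 1) * ((k - 2) * (k - 3))" unfolding 2[symmetric] by simp
    finally show ?thesis by (simp only: mult.assoc)
  qed
  let ?k = "m + N - 1"
  have le: "4 * ?k \<le> 5 * N" "4 * (?k - 1) \<le> 5 * (N - 1)" "4 * (?k - 2) \<le> 5 * (N - 2)" "4 * (?k - 3) \<le> 5 * (N - 3)"
    using assms by auto
  have "(4 * ?k) * (4 * (?k - 1)) * (4 * (?k - 2)) * (4 * (?k - 3))
      \<le> (5 * N) * (5 * (N - 1)) * (5 * (N - 2)) * (5 * (N - 3))"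
    by (intro mult_le_mono[OF mult_le_mono[OF mult_le_mono[OF le(1,2)] le(3)] le(4)])
  then have "256 * (24 * (?k choose 4)) \<le> 625 * (24 * (N choose 4))"
    unfolding fall by simp
  then show ?thesis by simp
qed

text \<open>The blocks are the connected components of the traces. Each contains a vertex on an edge
  with a free place, and the crude bound \<open>card M\<close> on their number is good enough for
  the count.\<close>

lemma initial_blocks:
  fixes c :: "'a set \<Rightarrow> nat"
  assumes M: "finite M" and supp: "\<And>A. c A > 0 \<Longrightarrow> A \<subseteq> M"
    and out: "\<And>v. v \<in> M \<Longrightarrow> \<exists>A. v \<in> A \<and> card A < h \<and> c A > 0"
    and count: "N + card M + c {} \<le> s * N + 1"
  shows "\<exists>B. linked_blocks h s N M c B"
proof -
  define R where "R = {(u, v) \<in> M \<times> M. (u, v) \<in> (trace_adj c)\<^sup>*}"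
  have sym: "sym ((trace_adj c)\<^sup>*)" by (intro sym_rtrancl) (auto simp: sym_def trace_adj_def)
  have eq: "equiv M R"
    by (rule equivI) (auto simp: R_def refl_on_def sym_def trans_def dest: symD[OF sym] rtrancl_trans)
  define B where "B = M // R"
  have part: "partition_on M B" unfolding B_def by (rule partition_on_quotient[OF eq])
  have "card B \<le> card M" unfolding B_def quotient_def
    using M card_UN_le[OF M, of "\<lambda>x. {R `` {x}}"] by simp
  then have num: "N + card B + c {} \<le> s * N + 1" using count by simp
  have cls: "A \<subseteq> R `` {v}" if "c A > 0" "v \<in> A" for A v
    using supp[OF that(1)] that by (auto simp: R_def trace_adj_def intro!: r_into_rtrancl)
  have cov: "\<exists>C\<in>B. A \<subseteq> C" if A: "c A > 0" "A \<noteq> {}" for A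
  proof -
    obtain v where v: "v \<in> A" using A by auto
    then have "R `` {v} \<in> B" using supp[OF A(1)] by (auto simp: B_def quotientI)
    then show ?thesis using cls[OF A(1) v] by blast
  qed
  have deg: "0 < out_degree h c C" if C: "C \<in> B" for C
  proof -
    obtain v where v: "v \<in> M" "C = R `` {v}" using C by (auto simp: B_def elim: quotientE)
    then obtain A where A: "v \<in> A" "card A < h" "c A > 0" using out by blast
    have "finite C" using v M by (auto simp: R_def intro: finite_subset)
    then have "(h - card A) * c A \<le> out_degree h c C"
      unfolding out_degree_def using cls[OF A(3,1)] A v by (intro member_le_sum) auto
    moreover have "(h - card A) * c A > 0" using A by simp
    ultimately show ?thesis by linarith
  qed
  have link: "(u, v) \<in> (trace_adj c)\<^sup>*" if "C \<in> B" "u \<in> C" "v \<in> C" for C u v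
    using quotient_eq_iff[OF eq, of C C u v] that by (auto simp: B_def R_def)
  have "linked_blocks h s N M c B"
    unfolding linked_blocks_def by (intro conjI allI impI ballI part num) (use cov deg link in auto)
  then show ?thesis by blast
qed

text \<open>The given factors enter through their multiplicities \<open>p\<close> and degrees
  \<open>\<rho>\<close>; what is missing at a vertex of \<open>M\<close> must come from edges
  meeting both \<open>M\<close> and \<open>V - M\<close>. Parallel copies are not yet told
  apart.\<close>

lemma colour_counts_exist:
  fixes V M :: "'a set" and J :: "'j set" and p :: "'j \<Rightarrow> 'a set \<Rightarrow> nat"
  assumes V: "finite V" "M \<subseteq> V" "card M = m" "card V = m + N"
    and m: "m > 5" and N: "N \<ge> 4 * m" and s: "s \<ge> 2" and J: "finite J"
    and \<rho>: "\<And>j. j \<in> J \<Longrightarrow> \<rho> j < s"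
    and psupp: "\<And>j A. j \<in> J \<Longrightarrow> p j A > 0 \<Longrightarrow> A \<subseteq> M \<and> card A = 5"
    and pcol: "\<And>A. A \<subseteq> M \<Longrightarrow> card A = 5 \<Longrightarrow> (\<Sum>j\<in>J. p j A) = l"
    and pdeg: "\<And>j v. j \<in> J \<Longrightarrow> v \<in> M \<Longrightarrow> (\<Sum>A\<in>Pow M. of_bool (v \<in> A) * p j A) = \<rho> j"
    and ptot: "(\<Sum>j\<in>J. \<rho> j) = l * ((m - 1) choose 4)"
    and k: "card J * s = l * ((m + N - 1) choose 4)"
    and div: "5 dvd s * (m + N)"
  shows "\<exists>c. (\<forall>j\<in>J. \<forall>A. c j A > 0 \<longrightarrow> A \<subseteq> V \<and> card A = 5) \<and>
    (\<forall>A. A \<subseteq> V \<longrightarrow> card A = 5 \<longrightarrow> (\<Sum>j\<in>J. c j A) = l) \<and>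
    (\<forall>j\<in>J. \<forall>A. A \<subseteq> M \<longrightarrow> card A = 5 \<longrightarrow> c j A = p j A) \<and>
    (\<forall>j\<in>J. \<forall>v\<in>V. (\<Sum>A\<in>Pow V. of_bool (v \<in> A) * c j A) = s) \<and>
    (\<forall>j\<in>J. \<forall>u\<in>V. \<forall>v\<in>V. (u, v) \<in> (trace_adj (c j))\<^sup>*)"
proof -
  define \<sigma> where "\<sigma> j = s - \<rho> j" for j
  define \<Lambda> where "\<Lambda> t = l * (N choose (5 - t))" for t
  define T where "T = {1, 2, 3, 4::nat}"
  have finM: "finite M" using V finite_subset by blast
  have finT: "finite T" by (simp add: T_def)
  have \<sigma>\<rho>: "\<sigma> j + \<rho> j = s" if "j \<in> J" for j using \<rho>[OF that] by (simp add: \<sigma>_def)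
  have sum5: "(\<Sum>i\<le>4. f i) = f 0 + f 1 + f 2 + f 3 + f 4" for f :: "nat \<Rightarrow> nat"
    by (simp add: eval_nat_numeral)
  \<comment> \<open>Vandermonde at a vertex of \<open>M\<close>, where the other four vertices of an
    edge are split between \<open>M\<close> and \<open>V - M\<close>. The term with all of them in
    \<open>M\<close> is the degree already used by the given factors.\<close>
  have tot: "(\<Sum>t\<in>T. t * (\<Lambda> t * (m choose t))) = (\<Sum>j\<in>J. \<sigma> j * m)"
  proof -
    have ab: "t * (m choose t) = m * ((m - 1) choose (t - 1))" if "t \<in> T" for t
    proof -
      have "Suc (t - 1) = t" using that by (auto simp: T_def)
      then show ?thesis using binomial_absorption[of "t - 1" m] by (simp only:)
    qed
    have "(\<Sum>t\<in>T. t * (\<Lambda> t * (m choose t))) = (\<Sum>t\<in>T. \<Lambda> t * (m * ((m - 1) choose (t - 1))))"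
      by (intro sum.cong refl) (metis ab mult.left_commute)
    also have "\<dots> + m * (l * ((m - 1) choose 4)) = m * (l * ((m - 1 + N) choose 4))"
      unfolding vandermonde[symmetric] sum5 by (simp add: T_def \<Lambda>_def algebra_simps)
    also have "m - 1 + N = m + N - 1" using m by simp
    finally have "(\<Sum>t\<in>T. t * (\<Lambda> t * (m choose t))) + m * (\<Sum>j\<in>J. \<rho> j) = m * (card J * s)"
      by (simp add: ptot k)
    also have "card J * s = (\<Sum>j\<in>J. \<sigma> j + \<rho> j)" using \<sigma>\<rho> by simp
    finally show ?thesis by (simp add: sum.distrib algebra_simps sum_distrib_left)
  qed
  \<comment> \<open>From \<open>s \<ge> 2\<close> and the growth estimate, \<open>card J\<close> is
    at most \<open>2 * l * (N choose 4)\<close>. Losing up to 3 places per colour thus costs at most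
    \<open>6 * l * (N choose 4)\<close>, which is where \<open>m > 5\<close> enters.\<close>
  have many: "3 * card J \<le> \<Lambda> 1 * (m choose 1)"
  proof -
    have "card J * 2 \<le> card J * s" using s by simp
    also have "\<dots> \<le> l * (4 * (N choose 4))" unfolding k using m N by (intro mult_left_mono binomial_4_growth) auto
    finally have "3 * card J \<le> 6 * (l * (N choose 4))" by simp
    also have "\<dots> \<le> m * (l * (N choose 4))" using m by (intro mult_right_mono) auto
    finally show ?thesis by (simp add: \<Lambda>_def mult_ac)
  qed
  have sz: "0 < t \<and> t \<le> Suc 3" if "t \<in> T" for t using that by (auto simp: T_def)
  have one: "1 \<in> T" by (simp add: T_def)
  from exact_packing[OF finT J sz one tot many] obtain e where
    e: "\<And>t. t \<in> T \<Longrightarrow> (\<Sum>j\<in>J. e j t) = \<Lambda> t * (card M choose t)"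
      "\<And>j. j \<in> J \<Longrightarrow> (\<Sum>t\<in>T. t * e j t) = \<sigma> j * card M"
    unfolding V(3) by blast
  obtain d where
    d: "\<forall>j\<in>J. \<forall>A. d j A > 0 \<longrightarrow> A \<subseteq> M \<and> card A \<in> T"
      "\<forall>A. A \<subseteq> M \<longrightarrow> card A \<in> T \<longrightarrow> (\<Sum>j\<in>J. d j A) = \<Lambda> (card A)"
      "\<forall>j\<in>J. \<forall>v\<in>M. (\<Sum>A\<in>Pow M. of_bool (v \<in> A) * d j A) = \<sigma> j"
    by atomize_elim (rule distribute_types[OF finM finT J e])
  have dsupp: "A \<subseteq> M \<and> card A \<in> T" if "j \<in> J" "d j A > 0" for j A using d(1) that by blast
  have dcol: "(\<Sum>j\<in>J. d j A) = \<Lambda> (card A)" if "A \<subseteq> M" "card A \<in> T" for A using d(2) that by blast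
  have ddeg: "(\<Sum>A\<in>Pow M. of_bool (v \<in> A) * d j A) = \<sigma> j" if "j \<in> J" "v \<in> M" for j v
    using d(3) that by blast
  define f where "f j A = d j A + p j A" for j A
  have fsupp: "A \<subseteq> M \<and> 1 \<le> card A \<and> card A \<le> 5" if "j \<in> J" "f j A > 0" for j A
    using dsupp[OF that(1), of A] psupp[OF that(1), of A] that by (auto simp: f_def T_def)
  have fdeg: "(\<Sum>A\<in>Pow M. of_bool (v \<in> A) * f j A) = s" if "j \<in> J" "v \<in> M" for j v
    using ddeg[OF that] pdeg[OF that] \<sigma>\<rho>[OF that(1)] by (simp add: f_def distrib_left sum.distrib)
  have finc: "(\<Sum>A\<in>Pow M. card A * f j A) = s * m" if "j \<in> J" for j
    using sum_incidences[OF finM, of "f j"] fdeg[OF that] V by (simp add: mult.commute)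
  \<comment> \<open>The degree sum in \<open>V - M\<close> already claimed by the edges of colour
    \<open>j\<close> that meet \<open>M\<close>.\<close>
  define Q where "Q j = (\<Sum>A\<in>Pow M. (5 - card A) * f j A)" for j
  have Q5: "Q j + s * m = 5 * (\<Sum>A\<in>Pow M. f j A)" if j: "j \<in> J" for j
  proof -
    have "Q j + s * m = (\<Sum>A\<in>Pow M. (5 - card A) * f j A + card A * f j A)"
      using finc[OF j] by (simp add: Q_def sum.distrib)
    also have "\<dots> = (\<Sum>A\<in>Pow M. 5 * f j A)"
    proof (intro sum.cong refl)
      fix A show "(5 - card A) * f j A + card A * f j A = 5 * f j A"
        using fsupp[OF j, of A] by (cases "f j A = 0") (auto simp flip: distrib_right)
    qed
    finally show ?thesis by (simp add: sum_distrib_left)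
  qed
  \<comment> \<open>An edge with \<open>t \<ge> 1\<close> vertices in \<open>M\<close> has
    \<open>5 - t \<le> 4 * t\<close> places outside, and the incidences in \<open>M\<close> number
    \<open>s * m\<close>; hence the need for \<open>4 * m \<le> N\<close>.\<close>
  have Qle: "Q j \<le> s * N" if j: "j \<in> J" for j
  proof -
    have "Q j \<le> (\<Sum>A\<in>Pow M. 4 * (card A * f j A))"
      unfolding Q_def
    proof (rule sum_mono)
      fix A
      show "(5 - card A) * f j A \<le> 4 * (card A * f j A)"
      proof (cases "f j A = 0")
        case False
        then have "5 - card A \<le> 4 * card A" using fsupp[OF j, of A] by auto
        then have "(5 - card A) * f j A \<le> (4 * card A) * f j A" by (rule mult_right_mono) simp
        then show ?thesis by (simp only: mult.assoc)
      qed simp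
    qed
    also have "\<dots> = s * (4 * m)" using finc[OF j] by (simp flip: sum_distrib_left)
    also have "\<dots> \<le> s * N" using N by simp
    finally show ?thesis .
  qed
  \<comment> \<open>The number of edges inside \<open>V - M\<close>, which become loops. The
    division is exact because \<open>s * (m + N)\<close> is a multiple of 5 and the edges meeting
    \<open>M\<close> have five places each.\<close>
  define L where "L j = (s * N - Q j) div 5" for j
  have L5: "5 * L j + Q j = s * N" if j: "j \<in> J" for j
  proof -
    have "s * N - Q j = s * (m + N) - 5 * (\<Sum>A\<in>Pow M. f j A)"
      using Q5[OF j] Qle[OF j] by (simp add: algebra_simps)
    then have "5 dvd s * N - Q j" using div by (simp add: dvd_diff_nat)
    then show ?thesis using Qle[OF j] by (simp add: L_def)
  qed
  \<comment> \<open>The colours' loop numbers were fixed one by one, yet their total is right: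
    Vandermonde counts the incidences in \<open>V - M\<close> by the trace size on \<open>M\<close>,
    and the term \<open>g 0\<close> belongs to the loops.\<close>
  have Lsum: "(\<Sum>j\<in>J. L j) = l * (N choose 5)"
  proof -
    define g where "g t = (m choose t) * ((N - 1) choose (4 - t))" for t
    have "(\<Sum>j\<in>J. Q j) = (\<Sum>A\<in>Pow M. (5 - card A) * (\<Sum>j\<in>J. f j A))"
      unfolding Q_def by (subst sum.swap) (simp flip: sum_distrib_left)
    also have "\<dots> = (\<Sum>A\<in>Pow M. if card A \<in> T then (5 - card A) * \<Lambda> (card A) else 0)"
    proof (intro sum.cong refl)
      fix A assume A: "A \<in> Pow M"
      show "(5 - card A) * (\<Sum>j\<in>J. f j A) = (if card A \<in> T then (5 - card A) * \<Lambda> (card A) else 0)"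
      proof (cases "card A \<in> T")
        case True
        then have "p j A = 0" if "j \<in> J" for j using psupp[OF that, of A] by (cases "p j A") (auto simp: T_def)
        then show ?thesis using dcol[of A] A True by (simp add: f_def)
      next
        case False
        then have "(5 - card A) * f j A = 0" if "j \<in> J" for j
          using fsupp[OF that, of A] by (auto simp: T_def)
        then have "(\<Sum>j\<in>J. (5 - card A) * f j A) = 0" by (intro sum.neutral) blast
        then show ?thesis unfolding sum_distrib_left using False by (simp only: if_False)
      qed
    qed
    also have "\<dots> = (\<Sum>t\<in>T. (m choose t) * ((5 - t) * \<Lambda> t))"
      using sum_Pow_by_card[OF finM finT, of "\<lambda>t. (5 - t) * \<Lambda> t"] V by simp
    also have "\<dots> = (\<Sum>t\<in>T. l * N * g t)"
    proof (intro sum.cong refl)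
      fix t assume "t \<in> T"
      then have t: "5 - t = Suc (4 - t)" by (auto simp: T_def)
      have "(5 - t) * (N choose (5 - t)) = N * ((N - 1) choose (4 - t))"
        unfolding t by (rule binomial_absorption)
      moreover have "(m choose t) * ((5 - t) * \<Lambda> t) = l * (m choose t) * ((5 - t) * (N choose (5 - t)))"
        unfolding \<Lambda>_def by (simp only: mult_ac)
      ultimately show "(m choose t) * ((5 - t) * \<Lambda> t) = l * N * g t"
        unfolding g_def by (simp only: mult_ac)
    qed
    finally have "(\<Sum>j\<in>J. Q j) + l * N * g 0 = l * N * (\<Sum>t\<le>4. g t)"
      unfolding sum5 by (simp add: T_def algebra_simps)
    also have "(\<Sum>t\<le>4. g t) = (m + (N - 1)) choose 4"
      unfolding g_def by (rule vandermonde)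
    also have "g 0 = (N - 1) choose 4" by (simp add: g_def)
    also have "m + (N - 1) = m + N - 1" using N m by simp
    also have "l * N * ((m + N - 1) choose 4) = card J * s * N" by (simp add: k)
    also have "card J * s * N = (\<Sum>j\<in>J. 5 * L j + Q j)" using L5 by simp
    finally have "5 * (\<Sum>j\<in>J. L j) = l * (N * ((N - 1) choose 4))"
      by (simp add: sum.distrib sum_distrib_left)
    also have "N * ((N - 1) choose 4) = 5 * (N choose 5)"
      using binomial_absorption[of 4 N] by simp
    finally show ?thesis by simp
  qed
  define c where "c j A = (if A = {} then L j else f j A)" for j A
  have f0: "f j {} = 0" if "j \<in> J" for j using fsupp[OF that, of "{}"] by auto
  have am: "amalgam {5} (\<lambda>_. l) J (\<lambda>_. s) N M (\<lambda>j _. c j)"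
    unfolding amalgam_def
  proof (intro conjI ballI allI impI)
    fix j t A assume j: "j \<in> J" and t: "t \<in> {5::nat}" and pos: "c j A > 0"
    then show "A \<subseteq> M" "card A \<le> t" using fsupp[OF j, of A] by (auto simp: c_def split: if_splits)
  next
    fix t A assume t: "t \<in> {5::nat}" and A: "A \<subseteq> M" "card A \<le> t"
    have finA: "finite A" using A finM finite_subset by blast
    show "(\<Sum>j\<in>J. c j A) = l * (N choose (t - card A))"
    proof (cases "A = {}")
      case True
      then show ?thesis using Lsum t by (simp add: c_def)
    next
      case False
      then have "card A \<noteq> 0" using finA by simp
      then consider "card A \<in> T" | "card A = 5" using A t by (force simp: T_def)
      then show ?thesis
      proof cases
        case 1
        then have "p j A = 0" if "j \<in> J" for j using psupp[OF that, of A] by (cases "p j A") (auto simp: T_def)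
        then show ?thesis using dcol[of A] A 1 t False by (simp add: c_def f_def \<Lambda>_def)
      next
        case 2
        then have "d j A = 0" if "j \<in> J" for j using dsupp[OF that, of A] by (cases "d j A") (auto simp: T_def)
        then show ?thesis using pcol[of A] A 2 t False by (simp add: c_def f_def)
      qed
    qed
  next
    fix j v assume jv: "j \<in> J" "v \<in> M"
    have "(\<Sum>A\<in>Pow M. of_bool (v \<in> A) * c j A) = (\<Sum>A\<in>Pow M. of_bool (v \<in> A) * f j A)"
      by (intro sum.cong) (auto simp: c_def)
    then show "(\<Sum>t\<in>{5::nat}. \<Sum>A\<in>Pow M. of_bool (v \<in> A) * c j A) = s" using fdeg[OF jv] by simp
  next
    fix j assume j: "j \<in> J"
    have "(\<Sum>A\<in>Pow M. (5 - card A) * c j A) = (\<Sum>A\<in>Pow M. (5 - card A) * f j A + (if A = {} then 5 * L j else 0))"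
      using f0[OF j] by (intro sum.cong) (auto simp: c_def)
    also have "\<dots> = s * N" using finM L5[OF j] by (simp add: sum.distrib Q_def)
    finally show "(\<Sum>t\<in>{5::nat}. \<Sum>A\<in>Pow M. (t - card A) * c j A) = s * N" by simp
  qed
  have blocks: "\<exists>B. linked_blocks 5 s N M (c j) B" if j: "j \<in> J" for j
  proof (rule initial_blocks[OF finM])
    show "A \<subseteq> M" if "c j A > 0" for A using fsupp[OF j, of A] that by (auto simp: c_def split: if_splits)
    show "\<exists>A. v \<in> A \<and> card A < 5 \<and> c j A > 0" if v: "v \<in> M" for v
    proof -
      have "(\<Sum>A\<in>Pow M. of_bool (v \<in> A) * d j A) \<noteq> 0" using ddeg[OF j v] \<rho>[OF j] by (simp add: \<sigma>_def)
      then obtain A where "of_bool (v \<in> A) * d j A \<noteq> 0" by (meson sum.neutral)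
      then have "v \<in> A" "d j A > 0" by auto
      then show ?thesis using dsupp[OF j, of A] by (intro exI[of _ A]) (auto simp: c_def f_def T_def)
    qed
    \<comment> \<open>In units of \<open>s * N\<close> the summands are at most 1/2, 1/8 and
      1/5.\<close>
    show "N + card M + c j {} \<le> s * N + 1"
    proof -
      have "5 * L j \<le> s * N" using L5[OF j] by simp
      moreover have "2 * N \<le> s * N" using s by simp
      moreover have "c j {} = L j" by (simp add: c_def)
      ultimately show ?thesis using V(3) N by linarith
    qed
  qed
  define X where "X = V - M"
  have X: "finite X" "X \<inter> M = {}" "card X = N" "X \<union> M = V"
    using V finM by (auto simp: X_def card_Diff_subset)
  from separate_vertices_linked[OF X(1) am J finM X(2)] blocks X
  obtain c' where c': "amalgam {5} (\<lambda>_. l) J (\<lambda>_. s) 0 V c'"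
    and bl: "\<And>j. j \<in> J \<Longrightarrow> \<exists>B. linked_blocks 5 s 0 V (c' j 5) B"
    and keep: "\<And>j A. j \<in> J \<Longrightarrow> A \<subseteq> M \<Longrightarrow> card A = 5 \<Longrightarrow> c' j 5 A = c j A"
    by auto
  have col: "(\<Sum>j\<in>J. c' j 5 A) = l * (0 choose (5 - card A))" if "A \<subseteq> V" "card A \<le> 5" for A
    using c' that by (simp add: amalgam_def)
  have supp: "A \<subseteq> V \<and> card A = 5" if j: "j \<in> J" "c' j 5 A > 0" for j A
  proof -
    have A: "A \<subseteq> V" "card A \<le> 5" using c' that by (auto simp: amalgam_def)
    have "card A = 5"
    proof (rule ccontr)
      assume "card A \<noteq> 5"
      then have "(\<Sum>j\<in>J. c' j 5 A) = 0" using col[OF A] A by (simp add: binomial_eq_0)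
      then show False using j J by simp
    qed
    then show ?thesis using A by simp
  qed
  have conn: "(u, v) \<in> (trace_adj (c' j 5))\<^sup>*" if j: "j \<in> J" and uv: "u \<in> V" "v \<in> V" for j u v
  proof -
    obtain B where B: "linked_blocks 5 s 0 V (c' j 5) B" using bl[OF j] by blast
    then have part: "partition_on V B" and "card B \<le> 1" by (auto simp: linked_blocks_def)
    moreover have "finite B" by (rule finite_elements[OF V(1) part])
    moreover have "\<Union>B = V" using part by (simp add: partition_on_def)
    ultimately obtain C where "C \<in> B" "u \<in> C" "v \<in> C"
      using uv by (metis UnionE card_le_Suc0_iff_eq One_nat_def)
    then show ?thesis using B by (auto simp: linked_blocks_def)
  qed
  show ?thesis
  proof (intro exI[of _ "\<lambda>j. c' j 5"] conjI ballI allI impI)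
    fix j A assume "j \<in> J" "A \<subseteq> M" "card A = 5"
    moreover from this have "d j A = 0" using dsupp[of j A] by (auto simp: T_def)
    ultimately show "c' j 5 A = p j A" using keep by (auto simp: c_def f_def)
  next
    fix j v assume "j \<in> J" "v \<in> V"
    then show "(\<Sum>A\<in>Pow V. of_bool (v \<in> A) * c' j 5 A) = s" using c' by (simp add: amalgam_def)
  qed (use col supp conn in auto)
qed

section \<open>Factorizations of labelled edges\<close>

lemma finite_complete_edges: "finite W \<Longrightarrow> finite (complete_edges l W h)"
  by (rule finite_subset[of _ "Pow W \<times> {..<l}"]) (auto simp: complete_edges_def)

lemma hdegree_eq_sum_copies:
  assumes W: "finite W" and F: "F \<subseteq> complete_edges l W h"
  shows "hdegree F v = (\<Sum>A\<in>Pow W. of_bool (v \<in> A) * card {i. (A, i) \<in> F})"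
proof -
  have "{e \<in> F. v \<in> fst e} = (SIGMA A:{A \<in> Pow W. v \<in> A}. {i. (A, i) \<in> F})"
    using F by (auto simp: complete_edges_def)
  moreover have "finite {i. (A, i) \<in> F}" for A
    by (rule finite_subset[of _ "{..<l}"]) (use F in \<open>auto simp: complete_edges_def\<close>)
  ultimately have "hdegree F v = (\<Sum>A | A \<in> Pow W \<and> v \<in> A. card {i. (A, i) \<in> F})"
    unfolding hdegree_def using W by (simp add: card_SigmaI)
  also have "\<dots> = (\<Sum>A\<in>Pow W. of_bool (v \<in> A) * card {i. (A, i) \<in> F})"
    using W by (intro sum.mono_neutral_cong_left) auto
  finally show ?thesis .
qed

lemma hdegree_complete_edges:
  assumes W: "finite W" and v: "v \<in> W" and h: "h > 0"
  shows "hdegree (complete_edges l W h) v = l * ((card W - 1) choose (h - 1))"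
proof -
  have ins: "{A. A \<subseteq> W \<and> card A = h \<and> v \<in> A} = insert v ` {A. A \<subseteq> W - {v} \<and> card A = h - 1}"
  proof (intro equalityI subsetI)
    fix A assume "A \<in> {A. A \<subseteq> W \<and> card A = h \<and> v \<in> A}"
    then have "A = insert v (A - {v})" "A - {v} \<subseteq> W - {v}" "card (A - {v}) = h - 1"
      using W by (auto dest: finite_subset)
    then show "A \<in> insert v ` {A. A \<subseteq> W - {v} \<and> card A = h - 1}" by blast
  next
    fix A assume "A \<in> insert v ` {A. A \<subseteq> W - {v} \<and> card A = h - 1}"
    then obtain B where B: "A = insert v B" "B \<subseteq> W - {v}" "card B = h - 1" by blast
    then have "finite B" "v \<notin> B" using W finite_subset by blast+
    then show "A \<in> {A. A \<subseteq> W \<and> card A = h \<and> v \<in> A}" using B v h by auto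
  qed
  have "inj_on (insert v) {A. A \<subseteq> W - {v} \<and> card A = h - 1}" by (auto simp: inj_on_def)
  then have "card {A. A \<subseteq> W \<and> card A = h \<and> v \<in> A} = (card W - 1) choose (h - 1)"
    unfolding ins using W v by (simp add: card_image n_subsets)
  moreover have "{e \<in> complete_edges l W h. v \<in> fst e} = {A. A \<subseteq> W \<and> card A = h \<and> v \<in> A} \<times> {..<l}"
    by (auto simp: complete_edges_def)
  ultimately show ?thesis by (simp add: hdegree_def card_cartesian_product)
qed

lemma factorization_card:
  assumes W: "finite W" and v: "v \<in> W" and h: "h > 0"
    and P: "is_factorization r W (complete_edges l W h) P"
  shows "finite P" "card P * r = l * ((card W - 1) choose (h - 1))"
proof -
  let ?E = "complete_edges l W h"
  have part: "partition_on ?E P" and fac: "\<And>F. F \<in> P \<Longrightarrow> F \<subseteq> ?E \<and> hdegree F v = r"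
    using P v by (auto simp: is_factorization_def is_factor_def)
  have finE: "finite ?E" by (rule finite_complete_edges[OF W])
  show finP: "finite P" by (rule finite_elements[OF finE part])
  have "{e \<in> ?E. v \<in> fst e} = (\<Union>F\<in>P. {e \<in> F. v \<in> fst e})"
    using part by (auto simp: partition_on_def)
  then have "hdegree ?E v = card (\<Union>F\<in>P. {e \<in> F. v \<in> fst e})" by (simp add: hdegree_def)
  also have "\<dots> = (\<Sum>F\<in>P. hdegree F v)"
    unfolding hdegree_def
  proof (rule card_UN_disjoint[OF finP])
    show "\<forall>F\<in>P. finite {e \<in> F. v \<in> fst e}" using fac finE finite_subset by fastforce
    show "\<forall>F\<in>P. \<forall>F'\<in>P. F \<noteq> F' \<longrightarrow> {e \<in> F. v \<in> fst e} \<inter> {e \<in> F'. v \<in> fst e} = {}"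
      using part by (fastforce simp: partition_on_def disjoint_def)
  qed
  also have "\<dots> = card P * r" using fac by simp
  finally show "card P * r = l * ((card W - 1) choose (h - 1))"
    using hdegree_complete_edges[OF W v h] by simp
qed

lemma factor_card:
  assumes W: "finite W" and F: "is_factor r W (complete_edges l W h) F"
  shows "h * card F = r * card W"
proof -
  have FE: "F \<subseteq> complete_edges l W h" and deg: "\<And>v. v \<in> W \<Longrightarrow> hdegree F v = r"
    using F by (auto simp: is_factor_def)
  have finF: "finite F" using FE finite_complete_edges[OF W] finite_subset by blast
  have "r * card W = (\<Sum>v\<in>W. hdegree F v)" using deg by simp
  also have "\<dots> = (\<Sum>v\<in>W. \<Sum>e\<in>F. of_bool (v \<in> fst e))"
    using finF by (simp add: hdegree_def Int_def)
  also have "\<dots> = (\<Sum>e\<in>F. \<Sum>v\<in>W. of_bool (v \<in> fst e))" by (rule sum.swap)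
  also have "\<dots> = (\<Sum>e\<in>F. h)"
  proof (intro sum.cong refl)
    fix e assume "e \<in> F"
    then have "e \<in> complete_edges l W h" using FE by blast
    then have "fst e \<subseteq> W" "card (fst e) = h" by (auto simp: complete_edges_def)
    then show "(\<Sum>v\<in>W. of_bool (v \<in> fst e)) = h" using W by (simp add: Int_absorb1)
  qed
  finally show ?thesis by (simp add: mult.commute)
qed

text \<open>One divisibility counts the edges of a factor, the other the factors at a vertex. A
  factor exists because \<open>h \<le> card W\<close> and \<open>l > 0\<close> provide an
  edge.\<close>

lemma factorization_admissible:
  assumes W: "finite W" and v: "v \<in> W" and h: "h > 0" "h \<le> card W" and l: "l > 0"
    and P: "is_factorization r W (complete_edges l W h) P"
  shows "admissible h (card W) r l" "P \<noteq> {}"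
proof -
  have card: "card P * r = l * ((card W - 1) choose (h - 1))"
    by (rule factorization_card[OF W v h(1) P])
  have "h - 1 \<le> card W - 1" using h by simp
  then have "card P * r \<noteq> 0" unfolding card using l by (simp add: binomial_eq_0_iff)
  then show ne: "P \<noteq> {}" by auto
  then obtain F where "F \<in> P" by blast
  then have "h * card F = r * card W" using P factor_card[OF W] by (auto simp: is_factorization_def)
  then show "admissible h (card W) r l"
    unfolding admissible_def card[symmetric] by (metis dvd_triv_left dvd_triv_right)
qed

lemma ex_labelling:
  fixes \<kappa> :: "'j \<Rightarrow> nat"
  assumes J: "finite J" and sum: "(\<Sum>j\<in>J. \<kappa> j) = l"
  shows "\<exists>f. (\<forall>i<l. f i \<in> J) \<and> (\<forall>j\<in>J. card {i. i < l \<and> f i = j} = \<kappa> j)"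
proof -
  let ?S = "SIGMA j:J. {..<\<kappa> j}"
  have "finite ?S" "card {..<l} = card ?S" using J sum by simp_all
  from finite_same_card_bij[OF finite_lessThan this] obtain f where f: "bij_betw f {..<l} ?S"
    by blast
  have "card {i. i < l \<and> fst (f i) = j} = \<kappa> j" if j: "j \<in> J" for j
  proof -
    have "f ` {i. i < l \<and> fst (f i) = j} = {j} \<times> {..<\<kappa> j}"
    proof -
      have "f ` {i. i < l \<and> fst (f i) = j} = {p \<in> f ` {..<l}. fst p = j}" by auto
      then show ?thesis using f j by (auto simp: bij_betw_def)
    qed
    moreover have "inj_on f {i. i < l \<and> fst (f i) = j}"
      using f by (auto simp: bij_betw_def intro: inj_on_subset)
    ultimately show ?thesis by (simp flip: card_image[of f])
  qed
  moreover have "fst (f i) \<in> J" if "i < l" for i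
    using bij_betw_apply[OF f, of i] that by auto
  ultimately show ?thesis by (intro exI[of _ "fst \<circ> f"]) auto
qed

section \<open>Necessity of the conditions\<close>

lemma factor_extends_less:
  assumes V: "finite V" "M \<subset> V" "M \<noteq> {}"
    and F: "is_factor r M (complete_edges l M h) F" and G: "is_factor s V (complete_edges l V h) G"
    and conn: "hconnected V G" and sub: "F \<subseteq> G"
  shows "r < s"
proof (rule ccontr)
  assume ge: "\<not> r < s"
  have finG: "finite G" using G finite_complete_edges[OF V(1)] finite_subset by (metis is_factor_def)
  \<comment> \<open>If \<open>r \<ge> s\<close>, then \<open>F\<close> exhausts the edges of
    \<open>G\<close> at each vertex of \<open>M\<close>. No edge of \<open>G\<close> leaves
    \<open>M\<close>, and \<open>V - M\<close> cannot be reached from \<open>M\<close>.\<close>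
  have inF: "e \<in> F" if e: "e \<in> G" "v \<in> fst e" and v: "v \<in> M" for e v
  proof -
    have "card {e \<in> G. v \<in> fst e} = s" "card {e \<in> F. v \<in> fst e} = r"
      using F G V v by (auto simp: is_factor_def hdegree_def)
    then have "{e \<in> F. v \<in> fst e} = {e \<in> G. v \<in> fst e}"
      using ge sub finG by (intro card_seteq) auto
    then show ?thesis using e by blast
  qed
  have stay: "v \<in> M" if "(u, v) \<in> (hadj G)\<^sup>*" "u \<in> M" for u v
    using that
  proof (induction rule: rtrancl_induct)
    case (step y z)
    then have yM: "y \<in> M" by simp
    from step(2) obtain e where e: "e \<in> G" "y \<in> fst e" "z \<in> fst e" by (auto simp: hadj_def)
    have "e \<in> F" by (rule inF[OF e(1,2) yM])
    then have "e \<in> complete_edges l M h" using F by (auto simp: is_factor_def)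
    then show ?case using e(3) by (auto simp: complete_edges_def)
  qed
  obtain u v where "u \<in> M" "v \<in> V" "v \<notin> M" using V by blast
  then show False using conn stay[of u v] V by (auto simp: hconnected_def)
qed

text \<open>Distinct \<open>r\<close>-factors lie in distinct \<open>s\<close>-factors, so
  \<open>card P \<le> card Q\<close>; both numbers are determined by vertex degrees, and comparing
  them gives the last inequality.\<close>

lemma extension_necessary:
  fixes V M :: "'a set"
  assumes V: "finite V" "M \<subset> V" "h \<le> card M" and h: "h > 0" and l: "l > 0" and r: "r > 0"
    and P: "is_factorization r M (complete_edges l M h) P"
    and ext: "extends_to_connected P s V (complete_edges l V h)"
  shows "admissible h (card M) r l" "admissible h (card V) s l" "r < s"
    "s * ((card M - 1) choose (h - 1)) \<le> r * ((card V - 1) choose (h - 1))"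
proof -
  have finM: "finite M" using V finite_subset by blast
  have "M \<noteq> {}" using V h by auto
  then obtain v where v: "v \<in> M" by blast
  then have vV: "v \<in> V" using V by blast
  obtain Q where Q: "is_connected_factorization s V (complete_edges l V h) Q"
    and cont: "\<forall>F\<in>P. \<exists>G\<in>Q. F \<subseteq> G"
    and dist: "\<forall>F\<in>P. \<forall>F'\<in>P. \<forall>G\<in>Q. \<forall>G'\<in>Q. F \<noteq> F' \<longrightarrow> F \<subseteq> G \<longrightarrow> F' \<subseteq> G' \<longrightarrow> G \<noteq> G'"
    using ext unfolding extends_to_connected_def by (elim exE conjE)
  have facQ: "is_factorization s V (complete_edges l V h) Q" and conn: "\<And>G. G \<in> Q \<Longrightarrow> hconnected V G"
    using Q by (auto simp: is_connected_factorization_def)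
  have hV: "h \<le> card V" using V psubset_card_mono[OF V(1,2)] by simp
  show "admissible h (card M) r l" by (rule factorization_admissible[OF finM v h V(3) l P])
  show "admissible h (card V) s l" by (rule factorization_admissible[OF V(1) vV h hV l facQ])
  have "P \<noteq> {}" by (rule factorization_admissible[OF finM v h V(3) l P])
  then obtain F where F: "F \<in> P" by blast
  with cont obtain G where "G \<in> Q" "F \<subseteq> G" by blast
  then show "r < s"
    using factor_extends_less[OF V(1,2) \<open>M \<noteq> {}\<close>, of r l h F s G] F P facQ conn
    by (auto simp: is_factorization_def)
  obtain g where g: "\<And>F. F \<in> P \<Longrightarrow> g F \<in> Q \<and> F \<subseteq> g F" using cont by metis
  have "inj_on g P"
  proof (rule inj_onI)
    fix F F' assume "F \<in> P" "F' \<in> P" "g F = g F'"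
    then show "F = F'" using dist g[of F] g[of F'] by blast
  qed
  moreover have "g ` P \<subseteq> Q" using g by blast
  ultimately have "card P \<le> card Q"
    using factorization_card(1)[OF V(1) vV h facQ] by (rule card_inj_on_le)
  let ?a = "(card M - 1) choose (h - 1)" and ?b = "(card V - 1) choose (h - 1)"
  have "l * (s * ?a) = s * (card P * r)" using factorization_card(2)[OF finM v h P] by simp
  also have "\<dots> \<le> s * (card Q * r)" using \<open>card P \<le> card Q\<close> by simp
  also have "\<dots> = r * (card Q * s)" by simp
  also have "\<dots> = l * (r * ?b)" using factorization_card(2)[OF V(1) vV h facQ] by simp
  finally show "s * ?a \<le> r * ?b" using l by simp
qed

text \<open>Degrees and connectedness depend only on how many copies of a vertex set have a given
  colour. The labels can thus be chosen separately for each vertex set, respecting the given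
  factors.\<close>

lemma extension_from_colour_counts:
  fixes V M :: "'a set" and F :: "nat \<Rightarrow> 'a hedge set" and c :: "nat \<Rightarrow> 'a set \<Rightarrow> nat"
  assumes V: "finite V" "V \<noteq> {}" "M \<subseteq> V" and s: "s > 0" and q: "q \<le> k"
    and P: "partition_on (complete_edges l M h) P" "bij_betw F {..<q} P"
    and supp: "\<And>j A. j < k \<Longrightarrow> c j A > 0 \<Longrightarrow> A \<subseteq> V \<and> card A = h"
    and col: "\<And>A. A \<subseteq> V \<Longrightarrow> card A = h \<Longrightarrow> (\<Sum>j<k. c j A) = l"
    and old: "\<And>j A. j < k \<Longrightarrow> A \<subseteq> M \<Longrightarrow> card A = h \<Longrightarrow> c j A = (if j < q then card {i. (A, i) \<in> F j} else 0)"
    and deg: "\<And>j v. j < k \<Longrightarrow> v \<in> V \<Longrightarrow> (\<Sum>A\<in>Pow V. of_bool (v \<in> A) * c j A) = s"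
    and conn: "\<And>j u v. j < k \<Longrightarrow> u \<in> V \<Longrightarrow> v \<in> V \<Longrightarrow> (u, v) \<in> (trace_adj (c j))\<^sup>*"
  shows "extends_to_connected P s V (complete_edges l V h)"
proof -
  let ?E = "complete_edges l V h"
  have FP: "F j \<in> P" if "j < q" for j using P(2) that by (auto simp: bij_betw_def)
  have Finj: "j = j'" if "j < q" "j' < q" "e \<in> F j" "e \<in> F j'" for j j' e
  proof -
    have "F j = F j'" using P(1) FP[OF that(1)] FP[OF that(2)] that(3,4)
      by (auto simp: partition_on_def disjoint_def)
    then show ?thesis using P(2) that(1,2) by (auto simp: bij_betw_def inj_on_def)
  qed
  have FE: "F j \<subseteq> complete_edges l M h" if "j < q" for j
    using P(1) FP[OF that] by (auto simp: partition_on_def)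
  define good where "good A f \<longleftrightarrow> (\<forall>i<l. f i < k) \<and> (\<forall>j<k. card {i. i < l \<and> f i = j} = c j A) \<and>
      (\<forall>j<q. \<forall>i. (A, i) \<in> F j \<longrightarrow> f i = j)" for A f
  have ex: "\<exists>f. good A f" if A: "A \<subseteq> V" "card A = h" for A
  proof (cases "A \<subseteq> M")
    case False
    then have "(A, i) \<notin> F j" if "j < q" for i j using FE[OF that] by (auto simp: complete_edges_def)
    then show ?thesis using ex_labelling[OF finite_lessThan col[OF A]] by (auto simp: good_def)
  next
    case True
    \<comment> \<open>Inside \<open>M\<close> there is no choice: every copy lies in exactly one
      given factor, which dictates its colour, and \<open>old\<close> makes the counts
      agree.\<close>
    have "\<exists>j<q. (A, i) \<in> F j" if "i < l" for i
    proof -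
      have "(A, i) \<in> \<Union>P" using P(1) True A that by (auto simp: partition_on_def complete_edges_def)
      then show ?thesis using P(2) by (auto simp: bij_betw_def)
    qed
    then obtain f where f: "\<And>i. i < l \<Longrightarrow> f i < q \<and> (A, i) \<in> F (f i)" by metis
    have lt: "i < l" if "j < q" "(A, i) \<in> F j" for i j using FE[OF that(1)] that(2) by (auto simp: complete_edges_def)
    have "card {i. i < l \<and> f i = j} = c j A" if j: "j < k" for j
    proof (cases "j < q")
      case j': True
      have "{i. i < l \<and> f i = j} = {i. (A, i) \<in> F j}"
        using f lt[OF j'] Finj[OF _ j'] by blast
      then show ?thesis using old[OF j True A(2)] j' by simp
    next
      case False
      then have "{i. i < l \<and> f i = j} = {}" using f by auto
      then show ?thesis using old[OF j True A(2)] False by (simp only: card.empty if_False)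
    qed
    moreover have "f i = j" if "j < q" "(A, i) \<in> F j" for i j
      using f[OF lt[OF that]] Finj that by blast
    moreover have "f i < k" if "i < l" for i using f[OF that] q by simp
    ultimately show ?thesis unfolding good_def by blast
  qed
  define \<phi> where "\<phi> A = (SOME f. good A f)" for A
  have good: "good A (\<phi> A)" if "A \<subseteq> V" "card A = h" for A
    unfolding \<phi>_def by (rule someI_ex[OF ex[OF that]])
  have \<phi>1: "\<phi> A i < k" if "A \<subseteq> V" "card A = h" "i < l" for A i
    using good[OF that(1,2)] that(3) by (simp add: good_def)
  have \<phi>2: "card {i. i < l \<and> \<phi> A i = j} = c j A" if "A \<subseteq> V" "card A = h" "j < k" for A j
    using good[OF that(1,2)] that(3) by (simp add: good_def)
  have \<phi>3: "\<phi> A i = j" if "A \<subseteq> V" "card A = h" "j < q" "(A, i) \<in> F j" for A i j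
    using good[OF that(1,2)] that(3,4) by (simp add: good_def)
  define G where "G j = {(A, i). (A, i) \<in> ?E \<and> \<phi> A i = j}" for j
  have GE: "G j \<subseteq> ?E" for j by (auto simp: G_def)
  have copies: "card {i. (A, i) \<in> G j} = c j A" if j: "j < k" and A: "A \<subseteq> V" for j A
  proof (cases "card A = h")
    case True
    then have "{i. (A, i) \<in> G j} = {i. i < l \<and> \<phi> A i = j}" using A by (auto simp: G_def complete_edges_def)
    then show ?thesis using \<phi>2[OF A True j] by simp
  next
    case False
    then have "{i. (A, i) \<in> G j} = {}" by (auto simp: G_def complete_edges_def)
    moreover have "c j A = 0" using supp[OF j, of A] False by auto
    ultimately show ?thesis by (simp only: card.empty)
  qed
  have Gdeg: "hdegree (G j) v = s" if "j < k" "v \<in> V" for j v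
    using hdegree_eq_sum_copies[OF V(1) GE] deg[OF that] copies[OF that(1)] by simp
  have Gne: "G j \<noteq> {}" if "j < k" for j
    using Gdeg[OF that] V(2) s by (auto simp: hdegree_def)
  have Gconn: "hconnected V (G j)" if j: "j < k" for j
  proof -
    have "trace_adj (c j) \<subseteq> hadj (G j)"
    proof
      fix p assume "p \<in> trace_adj (c j)"
      then obtain u v A where p: "p = (u, v)" "c j A > 0" "u \<in> A" "v \<in> A" by (auto simp: trace_adj_def)
      then have "card {i. (A, i) \<in> G j} > 0" using copies[OF j] supp[OF j, of A] by simp
      then have "{i. (A, i) \<in> G j} \<noteq> {}" by (metis card.empty less_irrefl)
      then show "p \<in> hadj (G j)" using p by (force simp: hadj_def)
    qed
    then show ?thesis unfolding hconnected_def using conn[OF j] rtrancl_mono by blast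
  qed
  define Q where "Q = G ` {..<k}"
  have part: "partition_on ?E Q"
  proof (rule partition_onI)
    show "\<Union>Q = ?E" using \<phi>1 GE by (auto simp: Q_def G_def complete_edges_def)
    show "{} \<notin> Q" using Gne by (auto simp: Q_def)
    show "disjnt X Y" if "X \<in> Q" "Y \<in> Q" "X \<noteq> Y" for X Y
      using that by (auto simp: Q_def G_def disjnt_def)
  qed
  have FG: "F j \<subseteq> G j" if j: "j < q" for j
  proof
    fix e assume e: "e \<in> F j"
    obtain A i where [simp]: "e = (A, i)" by (cases e)
    have "A \<subseteq> V" "card A = h" "i < l" using e FE[OF j] V(3) by (auto simp: complete_edges_def)
    then show "e \<in> G j" using \<phi>3[of A j i] j e by (auto simp: G_def complete_edges_def)
  qed
  \<comment> \<open>Distinctness is demanded for all classes containing the given factors, not just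
    for chosen ones; as factors are nonempty and classes disjoint, the containing class is
    unique.\<close>
  have only: "G j = X" if j: "j < q" and X: "X \<in> Q" "F j \<subseteq> X" for j X
  proof -
    have "F j \<noteq> {}" using partition_onD3[OF P(1)] FP[OF j] by metis
    then obtain e where "e \<in> F j" by blast
    then have "e \<in> G j" "e \<in> X" using FG[OF j] X by auto
    then show ?thesis using X by (auto simp: Q_def G_def)
  qed
  have Gneq: "G j \<noteq> G j'" if "j < k" "j' < k" "j \<noteq> j'" for j j'
    using Gne[OF that(1)] that(3) by (auto simp: G_def)
  show ?thesis
    unfolding extends_to_connected_def
  proof (intro exI[of _ Q] conjI ballI impI)
    show "is_connected_factorization s V ?E Q"
      unfolding is_connected_factorization_def is_factorization_def is_factor_def
      using part GE Gdeg Gconn by (auto simp: Q_def)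
  next
    fix X assume "X \<in> P"
    then obtain j where "j < q" "X = F j" using P(2) by (auto simp: bij_betw_def)
    then show "\<exists>Y\<in>Q. X \<subseteq> Y" using FG q by (intro bexI[of _ "G j"]) (auto simp: Q_def)
  next
    fix X X' Y Y' assume X: "X \<in> P" "X' \<in> P" "Y \<in> Q" "Y' \<in> Q" "X \<noteq> X'" "X \<subseteq> Y" "X' \<subseteq> Y'"
    obtain j j' where j: "j < q" "X = F j" "j' < q" "X' = F j'"
      using X(1,2) P(2) by (auto simp: bij_betw_def)
    have "Y = G j" "Y' = G j'" "j \<noteq> j'" using only[of j Y] only[of j' Y'] j X by auto
    then show "Y \<noteq> Y'" using Gneq[of j j'] j q by simp
  qed
qed

theorem theorem8p8:
  fixes m n r s l :: nat and V M :: "'a set" and P :: "'a hedge set set"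
  assumes "m > 5" and "n \<ge> 5 * m"
    and "r > 0" and "s > 0" and "l > 0"
    and "finite V" and "card V = n" and "M \<subseteq> V" and "card M = m"
    and "is_factorization r M (complete_edges l M 5) P"
  shows "extends_to_connected P s V (complete_edges l V 5) \<longleftrightarrow>
      (admissible 5 m r l \<and> admissible 5 n s l)
      \<and> (1 < real s / real r
          \<and> real s / real r \<le> real ((n - 1) choose 4) / real ((m - 1) choose 4))"
proof -
  let ?a = "(m - 1) choose 4" and ?b = "(n - 1) choose 4"
  have finM: "finite M" using assms finite_subset by blast
  have a: "?a > 0" using assms by (simp add: zero_less_binomial_iff)
  have ratio: "1 < real s / real r \<longleftrightarrow> r < s"
    "real s / real r \<le> real ?b / real ?a \<longleftrightarrow> s * ?a \<le> r * ?b"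
  proof -
    show "1 < real s / real r \<longleftrightarrow> r < s" using \<open>r > 0\<close> by simp
    have "real s / real r \<le> real ?b / real ?a \<longleftrightarrow> real (s * ?a) \<le> real (r * ?b)"
      using \<open>r > 0\<close> a by (simp add: field_simps)
    then show "real s / real r \<le> real ?b / real ?a \<longleftrightarrow> s * ?a \<le> r * ?b"
      by (simp only: of_nat_le_iff)
  qed
  obtain v where v: "v \<in> M" using assms by (metis card.empty ex_in_conv not_less_zero)
  have PM: "finite P" "card P * r = l * ?a"
    using factorization_card[OF finM v, of 5 r l P] assms by auto
  show ?thesis
  proof
    assume "extends_to_connected P s V (complete_edges l V 5)"
    moreover have "M \<subset> V" using assms by auto
    ultimately show "(admissible 5 m r l \<and> admissible 5 n s l)
      \<and> (1 < real s / real r \<and> real s / real r \<le> real ?b / real ?a)"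
      using extension_necessary[of V M 5 l r P s] assms unfolding ratio by simp
  next
    assume R: "(admissible 5 m r l \<and> admissible 5 n s l)
      \<and> (1 < real s / real r \<and> real s / real r \<le> real ?b / real ?a)"
    then have rs: "r < s" and sr: "s * ?a \<le> r * ?b" and n5: "5 dvd s * n" and "s dvd l * ?b"
      unfolding ratio admissible_def by auto
    \<comment> \<open>The number of colours, as forced by the degree of a vertex in the complete
      hypergraph.\<close>
    then obtain k where k: "k * s = l * ?b" by (metis dvd_div_mult_self)
    define q where "q = card P"
    have "q \<le> k"
    proof -
      have "(r * s) * q = l * (s * ?a)" using PM by (simp add: q_def mult_ac)
      also have "\<dots> \<le> l * (r * ?b)" using sr by simp
      also have "\<dots> = (r * s) * k" using k by (simp add: mult_ac)
      finally show ?thesis using \<open>r > 0\<close> \<open>s > 0\<close> by simp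
    qed
    obtain F where F: "bij_betw F {..<q} P"
      using ex_bij_betw_nat_finite[OF PM(1)] by (auto simp: q_def atLeast0LessThan)
    have part: "partition_on (complete_edges l M 5) P"
      and FF: "\<And>j. j < q \<Longrightarrow> is_factor r M (complete_edges l M 5) (F j)"
      using assms F by (auto simp: is_factorization_def bij_betw_def)
    have FE: "F j \<subseteq> complete_edges l M 5" if "j < q" for j using FF[OF that] by (simp add: is_factor_def)
    \<comment> \<open>Colours from \<open>q\<close> on extend no given factor: they have no edge
      inside \<open>M\<close> and must gain the full degree \<open>s\<close> from edges leaving
      it.\<close>
    define \<rho> where "\<rho> j = (if j < q then r else 0)" for j
    define p where "p j A = (if j < q then card {i. (A, i) \<in> F j} else 0)" for j A
    have fin: "finite {i. (A, i) \<in> F j}" if "j < q" for j A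
      by (rule finite_subset[of _ "{..<l}"]) (use FE[OF that] in \<open>auto simp: complete_edges_def\<close>)
    have split: "(\<Sum>j<k. if j < q then f j else 0) = (\<Sum>j<q. f j)" for f :: "nat \<Rightarrow> nat"
      using \<open>q \<le> k\<close> by (intro sum.mono_neutral_cong_right) auto
    obtain N where N: "n = m + N" "N \<ge> 4 * m" using assms(1,2) le_Suc_ex[of m n] by auto
    have "\<exists>c. (\<forall>j\<in>{..<k}. \<forall>A. c j A > 0 \<longrightarrow> A \<subseteq> V \<and> card A = 5) \<and>
      (\<forall>A. A \<subseteq> V \<longrightarrow> card A = 5 \<longrightarrow> (\<Sum>j\<in>{..<k}. c j A) = l) \<and>
      (\<forall>j\<in>{..<k}. \<forall>A. A \<subseteq> M \<longrightarrow> card A = 5 \<longrightarrow> c j A = p j A) \<and>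
      (\<forall>j\<in>{..<k}. \<forall>v\<in>V. (\<Sum>A\<in>Pow V. of_bool (v \<in> A) * c j A) = s) \<and>
      (\<forall>j\<in>{..<k}. \<forall>u\<in>V. \<forall>v\<in>V. (u, v) \<in> (trace_adj (c j))\<^sup>*)"
    proof (rule colour_counts_exist[where m = m and N = N and \<rho> = \<rho>])
      show "\<rho> j < s" if "j \<in> {..<k}" for j using rs by (simp add: \<rho>_def)
      show "A \<subseteq> M \<and> card A = 5" if "j \<in> {..<k}" "p j A > 0" for j A
      proof -
        have "j < q" "{i. (A, i) \<in> F j} \<noteq> {}"
          using that by (auto simp: p_def card_gt_0_iff split: if_splits)
        then show ?thesis using FE[of j] by (auto simp: complete_edges_def)
      qed
      show "(\<Sum>j\<in>{..<k}. p j A) = l" if A: "A \<subseteq> M" "card A = 5" for A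
      proof -
        have "(\<Sum>j\<in>{..<k}. p j A) = (\<Sum>j<q. card {i. (A, i) \<in> F j})" unfolding p_def by (rule split)
        also have "\<dots> = card (\<Union>j<q. {i. (A, i) \<in> F j})"
        proof (rule card_UN_disjoint[symmetric])
          show "\<forall>j\<in>{..<q}. \<forall>j'\<in>{..<q}. j \<noteq> j' \<longrightarrow> {i. (A, i) \<in> F j} \<inter> {i. (A, i) \<in> F j'} = {}"
          proof (intro ballI impI)
            fix j j' assume j: "j \<in> {..<q}" "j' \<in> {..<q}" "j \<noteq> j'"
            then have "F j \<noteq> F j'" "F j \<in> P" "F j' \<in> P" using F by (auto simp: bij_betw_def inj_on_def)
            then have "F j \<inter> F j' = {}" using part by (auto simp: partition_on_def disjoint_def)
            then show "{i. (A, i) \<in> F j} \<inter> {i. (A, i) \<in> F j'} = {}" by blast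
          qed
        qed (use fin in auto)
        also have "(\<Union>j<q. {i. (A, i) \<in> F j}) = {i. (A, i) \<in> \<Union>P}"
          using F by (auto simp: bij_betw_def)
        also have "\<dots> = {..<l}" using part A by (auto simp: partition_on_def complete_edges_def)
        finally show ?thesis by simp
      qed
      show "(\<Sum>A\<in>Pow M. of_bool (v \<in> A) * p j A) = \<rho> j" if "j \<in> {..<k}" "v \<in> M" for j v
        using hdegree_eq_sum_copies[OF finM FE, of j v] FF[of j] that
        by (auto simp: p_def \<rho>_def is_factor_def)
      show "(\<Sum>j\<in>{..<k}. \<rho> j) = l * ?a"
        unfolding \<rho>_def split using PM by (simp add: q_def)
    qed (use assms N rs k n5 in auto)
    then obtain c where c: "\<forall>j\<in>{..<k}. \<forall>A. c j A > 0 \<longrightarrow> A \<subseteq> V \<and> card A = 5"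
      "\<forall>A. A \<subseteq> V \<longrightarrow> card A = 5 \<longrightarrow> (\<Sum>j\<in>{..<k}. c j A) = l"
      "\<forall>j\<in>{..<k}. \<forall>A. A \<subseteq> M \<longrightarrow> card A = 5 \<longrightarrow> c j A = p j A"
      "\<forall>j\<in>{..<k}. \<forall>v\<in>V. (\<Sum>A\<in>Pow V. of_bool (v \<in> A) * c j A) = s"
      "\<forall>j\<in>{..<k}. \<forall>u\<in>V. \<forall>v\<in>V. (u, v) \<in> (trace_adj (c j))\<^sup>*"
      by (elim exE conjE) (rule that)
    show "extends_to_connected P s V (complete_edges l V 5)"
    proof (rule extension_from_colour_counts[where M = M and q = q and k = k and F = F and c = c])
      show "V \<noteq> {}" using v assms by auto
      show "c j A = (if j < q then card {i. (A, i) \<in> F j} else 0)" if "j < k" "A \<subseteq> M" "card A = 5" for j A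
        using c(3) that by (simp add: p_def)
    qed (use c(1,2,4,5) assms F part \<open>q \<le> k\<close> in auto)
  qed
qed

end
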